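(* Let $\mathcal{H}$ be a complex Hilbert space, $\{d_j\}_{j\in\mathbb{N}_0}\subset\mathbb{N}$, $\{e_j^k\}_{j\in\mathbb{N}_0,\,1\le k\le d_j}$ an orthonormal basis of $\mathcal{H}$, and $H_j:=\mathrm{span}\{e_j^k\}_{k=1}^{d_j}$. Let $0<r<\infty$. An operator $T\in\mathscr{L}(\mathcal{H})$ that is invariant relative to $\{H_j\}_{j\in\mathbb{N}_0}$, with symbol $\sigma$, is in the Schatten class $S_r(\mathcal{H})$ if and only if $$\sum_{\ell=0}^{\infty}\|\sigma(\ell)\|_{S_r(H_\ell)}^r<\infty.$$ Moreover, $$\|T\|_{S_r(\mathcal{H})}=\Big(\sum_{\ell=0}^{\infty}\|\sigma(\ell)\|_{S_r(H_\ell)}^r\Big)^{1/r}.$$ In particular, if $T$ is in the trace class $S_1(\mathcal{H})$, then $$\mathrm{Tr}(T)=\sum_{\ell=0}^{\infty}\mathrm{Tr}(\sigma(\ell)).$$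
   Context: $\mathbb{N}_0=\mathbb{N}\cup\{0\}$ with $\mathbb{N}=\{1,2,\dots\}$. $\mathscr{L}(\mathcal{H})$ is the space of bounded linear operators on $\mathcal{H}$. An operator $T\in\mathscr{L}(\mathcal{H})$ is called invariant (or a Fourier multiplier) relative to $\{H_j\}_{j\in\mathbb{N}_0}$ if $T(H_j)\subset H_j$ for every $j$; its matrix symbol (relative to the basis $\{e_j^k\}$) is the family of matrices $\sigma(j)\in\mathbb{C}^{d_j\times d_j}$ given by $\sigma(j)_{mk}=(Te_j^k,e_j^m)_{\mathcal{H}}$, $1\le m,k\le d_j$. For a compact operator $A$ on a Hilbert space, its singular values $s_k(A)$ are the eigenvalues (with multiplicity) of $|A|=(A^*A)^{1/2}$; for $0<r<\infty$, $A$ belongs to the Schatten class $S_r$ if $\sum_k s_k(A)^r<\infty$, and $\|A\|_{S_r}=(\sum_k s_k(A)^r)^{1/r}$ (a quasi-norm if $r<1$). $\|\sigma(\ell)\|_{S_r(H_\ell)}$ is this quantity for the matrix $\sigma(\ell)$ acting on $H_\ell\simeq\mathbb{C}^{d_\ell}$ via the orthonormal basis $\{e_\ell^k\}_{k=1}^{d_\ell}$. *)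

theory Defs
  imports
    "HOL-Analysis.Elementary_Metric_Spaces"
    "HOL-Analysis.Infinite_Sum"
    "Jordan_Normal_Form.Schur_Decomposition"
begin

text \<open>
  Complex Hilbert spaces. The inner product is linear in its \<^emph>\<open>first\<close> argument. The order on
  \<^typ>\<open>complex\<close> is that of \<^theory>\<open>HOL-Library.Complex_Order\<close>: \<open>0 \<le> z\<close> means that \<open>z\<close> is
  real and nonnegative.
\<close>

class complex_hilbert_space = banach +
  fixes scaleC :: "complex \<Rightarrow> 'a \<Rightarrow> 'a"
    and cinner :: "'a \<Rightarrow> 'a \<Rightarrow> complex"
  assumes scaleC_add_right: "scaleC a (x + y) = scaleC a x + scaleC a y"
    and scaleC_add_left: "scaleC (a + b) x = scaleC a x + scaleC b x"
    and scaleC_scaleC: "scaleC a (scaleC b x) = scaleC (a * b) x"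
    and scaleC_one: "scaleC 1 x = x"
    and scaleR_scaleC: "scaleR t x = scaleC (complex_of_real t) x"
    and cinner_commute: "cinner x y = cnj (cinner y x)"
    and cinner_add_left: "cinner (x + y) z = cinner x z + cinner y z"
    and cinner_scaleC_left: "cinner (scaleC a x) y = a * cinner x y"
    and cinner_ge_zero: "0 \<le> cinner x x"
    and cinner_eq_zero_iff: "cinner x x = 0 \<longleftrightarrow> x = 0"
    and norm_eq_sqrt_cinner: "norm x = sqrt (Re (cinner x x))"

global_interpretation complex_vector:
  vector_space "scaleC :: complex \<Rightarrow> 'a \<Rightarrow> 'a::complex_hilbert_space"
  defines cspan = complex_vector.span
    and cdim = complex_vector.dim
  by unfold_locales
    (rule scaleC_add_right scaleC_add_left scaleC_scaleC scaleC_one)+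

definition orthonormal_basis :: "'i set \<Rightarrow> ('i \<Rightarrow> 'a::complex_hilbert_space) \<Rightarrow> bool" where
  "orthonormal_basis I f \<longleftrightarrow>
     (\<forall>i\<in>I. \<forall>j\<in>I. cinner (f i) (f j) = (if i = j then 1 else 0)) \<and>
     closure (cspan (f ` I)) = UNIV"

definition bounded_clinear :: "('a::complex_hilbert_space \<Rightarrow> 'a) \<Rightarrow> bool" where
  "bounded_clinear A \<longleftrightarrow>
     bounded_linear A \<and> (\<forall>c x. A (scaleC c x) = scaleC c (A x))"

definition compact_op :: "('a::complex_hilbert_space \<Rightarrow> 'a) \<Rightarrow> bool" where
  "compact_op A \<longleftrightarrow> bounded_clinear A \<and> compact (closure (A ` cball 0 1))"

definition positive_op :: "('a::complex_hilbert_space \<Rightarrow> 'a) \<Rightarrow> bool" where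
  "positive_op A \<longleftrightarrow> bounded_clinear A \<and> (\<forall>x. 0 \<le> cinner (A x) x)"

definition adjoint_op :: "('a::complex_hilbert_space \<Rightarrow> 'a) \<Rightarrow> 'a \<Rightarrow> 'a" where
  "adjoint_op A = (THE B. \<forall>x y. cinner (A x) y = cinner x (B y))"

definition abs_op :: "('a::complex_hilbert_space \<Rightarrow> 'a) \<Rightarrow> 'a \<Rightarrow> 'a" where
  "abs_op A = (THE B. positive_op B \<and> B \<circ> B = adjoint_op A \<circ> A)"

definition eigenspace_op :: "('a::complex_hilbert_space \<Rightarrow> 'a) \<Rightarrow> complex \<Rightarrow> 'a set" where
  "eigenspace_op A c = {x. A x = scaleC c x}"

text \<open>
  The eigenvalues of \<open>|A|\<close> counted with multiplicity, as a family: the index \<open>(s, k)\<close> stands for the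
  \<open>k\<close>-th copy of the singular value \<open>s\<close>, and the family maps it to \<open>s\<close>. A number \<open>s\<close> that is not an
  eigenvalue has eigenspace \<open>{0}\<close> and contributes no index. The eigenvalues of a positive operator
  are nonnegative reals. By the library convention that an infinite-dimensional space has
  \<^const>\<open>cdim\<close> equal to 0, an infinite-dimensional kernel contributes no index, which is harmless
  since \<open>0 powr r = 0\<close>; for compact \<open>A\<close> all other multiplicities are finite.
\<close>

definition singular_index :: "('a::complex_hilbert_space \<Rightarrow> 'a) \<Rightarrow> (real \<times> nat) set" where
  "singular_index A =
     (SIGMA s:UNIV. {k. k < cdim (eigenspace_op (abs_op A) (complex_of_real s))})"

definition schatten_class :: "real \<Rightarrow> ('a::complex_hilbert_space \<Rightarrow> 'a) set" where
  "schatten_class r =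
     {A. compact_op A \<and> (\<lambda>(s, k). s powr r) summable_on singular_index A}"

definition schatten_norm :: "real \<Rightarrow> ('a::complex_hilbert_space \<Rightarrow> 'a) \<Rightarrow> real" where
  "schatten_norm r A = (\<Sum>\<^sub>\<infinity>(s, k)\<in>singular_index A. s powr r) powr (1 / r)"

text \<open>
  The trace is the common value of \<open>\<Sum> (A b, b)\<close> over all orthonormal bases (a basis given as a
  set is indexed by itself).
\<close>

definition trace_op :: "('a::complex_hilbert_space \<Rightarrow> 'a) \<Rightarrow> complex" where
  "trace_op A =
     (THE t. \<forall>B. orthonormal_basis B (\<lambda>b. b) \<longrightarrow> ((\<lambda>b. cinner (A b) b) has_sum t) B)"

text \<open>
  The same notions for square complex matrices. The multiplicity of an eigenvalue of the
  positive semidefinite, hence diagonalizable, matrix \<open>|A|\<close> is taken as its multiplicity as a root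
  of the characteristic polynomial.
\<close>

definition positive_mat :: "complex mat \<Rightarrow> bool" where
  "positive_mat A \<longleftrightarrow>
     square_mat A \<and> (\<forall>v\<in>carrier_vec (dim_row A). 0 \<le> (A *\<^sub>v v) \<bullet>c v)"

definition abs_mat :: "complex mat \<Rightarrow> complex mat" where
  "abs_mat A = (THE B. positive_mat B \<and> B * B = mat_adjoint A * A)"

definition singular_index_mat :: "complex mat \<Rightarrow> (real \<times> nat) set" where
  "singular_index_mat A =
     (SIGMA s:UNIV. {k. k < Polynomial.order (complex_of_real s) (char_poly (abs_mat A))})"

definition schatten_norm_mat :: "real \<Rightarrow> complex mat \<Rightarrow> real" where
  "schatten_norm_mat r A = (\<Sum>(s, k)\<in>singular_index_mat A. s powr r) powr (1 / r)"

definition trace_mat :: "complex mat \<Rightarrow> complex" where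
  "trace_mat A = (\<Sum>i<dim_row A. A $$ (i, i))"

text \<open>
  The basis vectors are \<open>e j k\<close> with \<open>1 \<le> k \<le> d j\<close>, whereas matrix entries are indexed from 0.
\<close>

definition basis_index :: "(nat \<Rightarrow> nat) \<Rightarrow> (nat \<times> nat) set" where
  "basis_index d = (SIGMA j:UNIV. {1..d j})"

definition block ::
  "(nat \<Rightarrow> nat) \<Rightarrow> (nat \<Rightarrow> nat \<Rightarrow> 'a::complex_hilbert_space) \<Rightarrow> nat \<Rightarrow> 'a set" where
  "block d e j = cspan (e j ` {1..d j})"

definition invariant_op :: "(nat \<Rightarrow> 'a set) \<Rightarrow> ('a::complex_hilbert_space \<Rightarrow> 'a) \<Rightarrow> bool" where
  "invariant_op H A \<longleftrightarrow> (\<forall>j. A ` H j \<subseteq> H j)"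

definition symbol ::
  "(nat \<Rightarrow> nat) \<Rightarrow> (nat \<Rightarrow> nat \<Rightarrow> 'a::complex_hilbert_space) \<Rightarrow> ('a \<Rightarrow> 'a) \<Rightarrow> nat \<Rightarrow> complex mat"
  where
  "symbol d e A j =
     mat (d j) (d j) (\<lambda>(m, k). cinner (A (e j (Suc k))) (e j (Suc m)))"

end

theory Submission
  imports Defs "HOL-Analysis.L2_Norm" "HOL-Analysis.Topology_Euclidean_Space"
begin


text \<open>
  Everything reduces to one orthonormal basis that is adapted both to the blocks and to \<open>|T|\<close>.
  On a single block \<open>H\<^sub>l\<close>, which is finite-dimensional and mapped into itself by \<open>T\<close>, the singular
  value decomposition gives an orthonormal basis \<open>f\<^sub>l\<^sub>k\<close> (\<open>k < d\<^sub>l\<close>) whose images \<open>T f\<^sub>l\<^sub>k\<close> are pairwise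
  orthogonal (lemma \<open>SVD_finite_dimensional\<close>). It is found greedily: a unit vector at which \<open>\<parallel>T u\<parallel>\<close>
  is maximal among the vectors orthogonal to the earlier choices has an image orthogonal to the image
  of everything orthogonal to \<open>u\<close>. Since different blocks are orthogonal and invariant, all the
  \<open>f\<^sub>l\<^sub>k\<close> together form an orthonormal basis of the whole space with
  \<open>(T f\<^sub>p, T f\<^sub>q) = \<delta>\<^sub>p\<^sub>q s\<^sub>p\<^sup>2\<close>, \<open>s\<^sub>p = \<parallel>T f\<^sub>p\<parallel>\<close>.

  For such a basis (locale \<open>singular_basis\<close>) the numbers \<open>s\<^sub>p\<close> are the singular values of \<open>T\<close>: one has
  \<open>T\<^sup>*T f\<^sub>p = s\<^sub>p\<^sup>2 f\<^sub>p\<close>, every positive square root of \<open>T\<^sup>*T\<close> must map \<open>f\<^sub>p\<close> to \<open>s\<^sub>p f\<^sub>p\<close>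
  (\<open>positive_sqrt_eigenvector\<close>), so \<open>|T|\<close> is diagonal, and the eigenspace for \<open>t\<close> has dimension
  \<open>#{p. s\<^sub>p = t}\<close> (\<open>cdim_eigenspace\<close>). Moreover \<open>T\<close> is compact iff only finitely many \<open>s\<^sub>p\<close>
  exceed any given \<open>\<epsilon> > 0\<close>, which is automatic when \<open>\<Sum>\<^sub>p s\<^sub>p\<^sup>r\<close> converges. Hence \<open>T \<in> S\<^sub>r\<close> iff
  \<open>\<Sum>\<^sub>p s\<^sub>p\<^sup>r < \<infinity>\<close>, and this sum is \<open>\<parallel>T\<parallel>\<^sup>r\<close>.

  The same vectors, written in the coordinates of the given basis of \<open>H\<^sub>l\<close>, are the columns of a
  unitary matrix \<open>U\<close> with \<open>(\<sigma>(l) U)\<^sup>*(\<sigma>(l) U) = diag(s\<^sub>l\<^sub>k\<^sup>2)\<close>. So \<open>|\<sigma>(l)| = U diag(s\<^sub>l\<^sub>k) U\<^sup>*\<close> and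
  \<open>\<parallel>\<sigma>(l)\<parallel>\<^sup>r = \<Sum>\<^sub>k s\<^sub>l\<^sub>k\<^sup>r\<close> (locale \<open>singular_mat\<close>). Grouping \<open>\<Sum>\<^sub>p s\<^sub>p\<^sup>r\<close> by blocks, which is harmless
  for nonnegative terms, gives the criterion and the norm formula.

  For \<open>r = 1\<close> the bound \<open>\<Sum>\<^sub>p s\<^sub>p < \<infinity>\<close> makes a double series absolutely convergent, and exchanging the
  order of summation shows that \<open>\<Sum>\<^sub>b (T b, b)\<close> is the same for all orthonormal bases
  (\<open>diagonal_sum_basis_independent\<close>). Evaluated in the given basis and grouped by blocks it is
  \<open>\<Sum>\<^sub>l Tr \<sigma>(l)\<close>.
\<close>

section \<open>Geometry of complex Hilbert spaces\<close>

lemma cinner_zero_left [simp]: "cinner 0 (y::'a::complex_hilbert_space) = 0"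
  using cinner_add_left[of 0 0 y] by simp

lemma cinner_zero_right [simp]: "cinner (y::'a::complex_hilbert_space) 0 = 0"
  using cinner_commute[of y 0] by simp

lemma cinner_minus_left [simp]: "cinner (- x) (y::'a::complex_hilbert_space) = - cinner x y"
  using cinner_add_left[of x "- x" y] by (simp add: eq_neg_iff_add_eq_0 add.commute)

lemma cinner_diff_left: "cinner (x - z) (y::'a::complex_hilbert_space) = cinner x y - cinner z y"
  using cinner_add_left[of x "- z" y] by simp

lemma cinner_add_right: "cinner (x::'a::complex_hilbert_space) (y + z) = cinner x y + cinner x z"
  using cinner_commute[of x "y + z"] cinner_commute[of x y] cinner_commute[of x z]
  by (simp add: cinner_add_left)

lemma cinner_scaleC_right: "cinner (x::'a::complex_hilbert_space) (scaleC c y) = cnj c * cinner x y"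
  using cinner_commute[of x "scaleC c y"] cinner_commute[of x y]
  by (simp add: cinner_scaleC_left)

lemma cinner_diff_right: "cinner (x::'a::complex_hilbert_space) (y - z) = cinner x y - cinner x z"
  using cinner_commute[of x "y - z"] cinner_commute[of x y] cinner_commute[of x z]
  by (simp add: cinner_diff_left)

lemma cinner_sum_left: "cinner (\<Sum>i\<in>A. g i) (y::'a::complex_hilbert_space) = (\<Sum>i\<in>A. cinner (g i) y)"
  by (induction A rule: infinite_finite_induct) (auto simp: cinner_add_left)

lemma cinner_sum_right: "cinner (y::'a::complex_hilbert_space) (\<Sum>i\<in>A. g i) = (\<Sum>i\<in>A. cinner y (g i))"
  by (induction A rule: infinite_finite_induct) (auto simp: cinner_add_right)

lemma cinner_self: "cinner x (x::'a::complex_hilbert_space) = complex_of_real ((norm x)\<^sup>2)"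
proof -
  have "0 \<le> cinner x x" by (rule cinner_ge_zero)
  then have "0 \<le> Re (cinner x x)" "Im (cinner x x) = 0" by (auto simp: less_eq_complex_def)
  then show ?thesis by (simp add: norm_eq_sqrt_cinner complex_eq_iff)
qed

lemma norm_scaleC [simp]: "norm (scaleC c (x::'a::complex_hilbert_space)) = cmod c * norm x"
proof -
  have "cinner (scaleC c x) (scaleC c x) = (c * cnj c) * cinner x x"
    by (simp add: cinner_scaleC_left cinner_scaleC_right)
  then have "complex_of_real ((norm (scaleC c x))\<^sup>2) = complex_of_real ((cmod c * norm x)\<^sup>2)"
    by (simp add: cinner_self complex_norm_square[symmetric] power_mult_distrib)
  then have "(norm (scaleC c x))\<^sup>2 = (cmod c * norm x)\<^sup>2"
    using of_real_eq_iff by blast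
  then show ?thesis by (simp add: power2_eq_iff_nonneg)
qed

lemma norm_add_square:
  "(norm (x + y))\<^sup>2 = (norm x)\<^sup>2 + (norm y)\<^sup>2 + 2 * Re (cinner x (y::'a::complex_hilbert_space))"
proof -
  have "complex_of_real ((norm (x + y))\<^sup>2) = cinner x x + cinner y y + (cinner x y + cnj (cinner x y))"
    using cinner_commute[of y x]
    by (simp only: cinner_self[symmetric]) (simp add: cinner_add_left cinner_add_right)
  then have "complex_of_real ((norm (x + y))\<^sup>2) =
      complex_of_real ((norm x)\<^sup>2 + (norm y)\<^sup>2 + 2 * Re (cinner x y))"
    by (simp add: cinner_self complex_add_cnj)
  then show ?thesis using of_real_eq_iff by blast
qed

text \<open>Minimizing \<open>\<parallel>x + c y\<parallel>\<close> over \<open>c\<close> leaves \<open>\<parallel>x\<parallel>\<^sup>2 - |(x, y)|\<^sup>2 / \<parallel>y\<parallel>\<^sup>2\<close>, which is nonnegative.\<close>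

lemma Cauchy_Schwarz: "cmod (cinner x y) \<le> norm x * norm (y::'a::complex_hilbert_space)"
proof (cases "y = 0")
  case False
  define c where "c = - (cinner x y / (norm y)\<^sup>2)"
  have "(norm (x + scaleC c y))\<^sup>2 = (norm x)\<^sup>2 + (cmod c * norm y)\<^sup>2 + 2 * Re (cnj c * cinner x y)"
    by (simp add: norm_add_square cinner_scaleC_right)
  also have "cnj c * cinner x y = - complex_of_real ((cmod (cinner x y))\<^sup>2 / (norm y)\<^sup>2)"
    by (simp add: c_def complex_norm_square[symmetric] mult.commute[of "cnj _"])
  also have "(cmod c * norm y)\<^sup>2 = (cmod (cinner x y))\<^sup>2 / (norm y)\<^sup>2"
    using False by (simp add: c_def norm_divide norm_mult power2_eq_square)
  finally have "(cmod (cinner x y))\<^sup>2 / (norm y)\<^sup>2 \<le> (norm x)\<^sup>2"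
    by (smt (verit) Re_complex_of_real uminus_complex.sel(1) zero_le_power2)
  then have "(cmod (cinner x y))\<^sup>2 \<le> (norm x * norm y)\<^sup>2"
    using False by (simp add: divide_le_eq power_mult_distrib)
  then show ?thesis by (rule power2_le_imp_le) simp
qed simp

lemma bounded_linear_cinner_left: "bounded_linear (\<lambda>x. cinner x (y::'a::complex_hilbert_space))"
  by (rule bounded_linear_intro[where K = "norm y"])
     (auto simp: cinner_add_left scaleR_scaleC cinner_scaleC_left Cauchy_Schwarz scaleR_conv_of_real)

lemma bounded_linear_cinner_right: "bounded_linear (\<lambda>x. cinner (y::'a::complex_hilbert_space) x)"
  by (rule bounded_linear_intro[where K = "norm y"])
     (auto simp: cinner_add_right scaleR_scaleC cinner_scaleC_right scaleR_conv_of_real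
       Cauchy_Schwarz[of y, unfolded mult.commute[of "norm y"]])

lemma bounded_linear_scaleC: "bounded_linear (scaleC c :: 'a \<Rightarrow> 'a::complex_hilbert_space)"
  by (rule bounded_linear_intro[where K = "cmod c"])
     (auto simp: scaleC_add_right scaleR_scaleC scaleC_scaleC mult.commute)

lemma bounded_linear_scaleC_left: "bounded_linear (\<lambda>c. scaleC c (x :: 'a::complex_hilbert_space))"
  by (rule bounded_linear_intro[where K = "norm x"])
     (auto simp: scaleC_add_left scaleR_scaleC scaleC_scaleC scaleR_conv_of_real)

lemma eq_zero_if_cinner_zero: "(\<And>y. cinner (x::'a::complex_hilbert_space) y = 0) \<Longrightarrow> x = 0"
  using cinner_eq_zero_iff by blast

lemma bounded_clinearD:
  assumes "bounded_clinear (A :: 'a::complex_hilbert_space \<Rightarrow> 'a)"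
  shows "bounded_linear A" "A (x + y) = A x + A y" "A (scaleC c x) = scaleC c (A x)"
    "A (x - y) = A x - A y" "A 0 = 0" "A (\<Sum>i\<in>F. g i) = (\<Sum>i\<in>F. A (g i))"
proof -
  show *: "bounded_linear A" using assms by (simp add: bounded_clinear_def)
  interpret bounded_linear A by fact
  show "A (x + y) = A x + A y" "A (scaleC c x) = scaleC c (A x)"
    "A (x - y) = A x - A y" "A 0 = 0" "A (\<Sum>i\<in>F. g i) = (\<Sum>i\<in>F. A (g i))"
    using assms by (auto simp: bounded_clinear_def add diff zero sum)
qed


section \<open>Orthonormal families\<close>

definition orthonormal :: "'i set \<Rightarrow> ('i \<Rightarrow> 'a::complex_hilbert_space) \<Rightarrow> bool" where
  "orthonormal I f \<longleftrightarrow> (\<forall>i\<in>I. \<forall>j\<in>I. cinner (f i) (f j) = (if i = j then 1 else 0))"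

lemma orthonormalD:
  "orthonormal I f \<Longrightarrow> i \<in> I \<Longrightarrow> j \<in> I \<Longrightarrow> cinner (f i) (f j) = (if i = j then 1 else 0)"
  by (auto simp: orthonormal_def)

lemma orthonormal_subset: "orthonormal I f \<Longrightarrow> J \<subseteq> I \<Longrightarrow> orthonormal J f"
  unfolding orthonormal_def by blast

lemma orthonormal_norm: "orthonormal I f \<Longrightarrow> i \<in> I \<Longrightarrow> norm (f i) = 1"
  by (simp add: orthonormal_def norm_eq_sqrt_cinner)

lemma orthonormal_inj_on:
  assumes "orthonormal I f" shows "inj_on f I"
  by (rule inj_onI) (metis assms orthonormalD zero_neq_one)

lemma cinner_sum_orthonormal:
  assumes "orthonormal I f" "finite F" "F \<subseteq> I" "j \<in> I"
  shows "cinner (\<Sum>i\<in>F. scaleC (c i) (f i)) (f j) = (if j \<in> F then c j else 0)"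
proof -
  have "cinner (\<Sum>i\<in>F. scaleC (c i) (f i)) (f j) = (\<Sum>i\<in>F. c i * (if i = j then 1 else 0))"
    unfolding cinner_sum_left cinner_scaleC_left
    by (rule sum.cong) (use assms in \<open>auto simp: orthonormalD subset_iff\<close>)
  also have "\<dots> = (if j \<in> F then c j else 0)"
    using assms(2) by (simp add: if_distrib sum.delta cong: if_cong)
  finally show ?thesis .
qed

lemma norm_sum_orthonormal:
  assumes "orthonormal I f" "finite F" "F \<subseteq> I"
  shows "(norm (\<Sum>i\<in>F. scaleC (c i) (f i)))\<^sup>2 = (\<Sum>i\<in>F. (cmod (c i))\<^sup>2)"
proof -
  let ?s = "\<Sum>i\<in>F. scaleC (c i) (f i)"
  have "complex_of_real ((norm ?s)\<^sup>2) = (\<Sum>j\<in>F. cnj (c j) * cinner ?s (f j))"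
    unfolding cinner_self[symmetric]
    by (simp only: cinner_sum_right cinner_scaleC_right)
  also have "\<dots> = (\<Sum>j\<in>F. cnj (c j) * c j)"
    by (rule sum.cong) (use assms in \<open>auto simp: cinner_sum_orthonormal[OF assms] subset_iff\<close>)
  also have "\<dots> = complex_of_real (\<Sum>i\<in>F. (cmod (c i))\<^sup>2)"
    by (simp add: complex_norm_square mult.commute del: of_real_power)
  finally show ?thesis using of_real_eq_iff by blast
qed

lemma orthonormal_independent:
  assumes "orthonormal I f" shows "complex_vector.independent (f ` I)"
  unfolding complex_vector.dependent_explicit
proof safe
  fix S u v assume S: "finite S" "S \<subseteq> f ` I" "(\<Sum>v\<in>S. scaleC (u v) v) = 0" and v: "v \<in> S" "u v \<noteq> 0"
  have "orthonormal (f ` I) (\<lambda>x. x)"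
    using orthonormalD[OF assms] inj_onD[OF orthonormal_inj_on[OF assms]]
    unfolding orthonormal_def ball_simps by force
  from cinner_sum_orthonormal[OF this S(1,2), of v u] S v show False by auto
qed

lemma Bessel_finite:
  assumes "orthonormal I f" "finite F" "F \<subseteq> I"
  shows "(\<Sum>i\<in>F. (cmod (cinner x (f i)))\<^sup>2) \<le> (norm x)\<^sup>2"
proof -
  let ?p = "\<Sum>i\<in>F. scaleC (cinner x (f i)) (f i)"
  have "cinner (x - ?p) (f j) = 0" if "j \<in> F" for j
    using cinner_sum_orthonormal[OF assms, of j] assms that by (auto simp: cinner_diff_left)
  then have "cinner (x - ?p) ?p = 0" by (simp add: cinner_sum_right cinner_scaleC_right)
  then have "(norm ((x - ?p) + ?p))\<^sup>2 = (norm (x - ?p))\<^sup>2 + (norm ?p)\<^sup>2"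
    by (simp only: norm_add_square) simp
  then show ?thesis by (simp add: norm_sum_orthonormal[OF assms])
qed

lemma Bessel_summable:
  assumes "orthonormal I f"
  shows "(\<lambda>i. (cmod (cinner x (f i)))\<^sup>2) summable_on I"
  using Bessel_finite[OF assms]
  by (intro nonneg_bounded_partial_sums_imp_summable_on[where C = "(norm x)\<^sup>2"])
     (auto intro!: eventually_finite_subsets_at_top_weakI)

text \<open>The finite partial sums form a Cauchy filter, because the norm of a difference is governed
  by a tail of the convergent series of squares.\<close>

lemma Riesz_Fischer:
  fixes f :: "'i \<Rightarrow> 'a::complex_hilbert_space"
  assumes on: "orthonormal I f" and c: "(\<lambda>i. (cmod (c i))\<^sup>2) summable_on I"
  shows "(\<lambda>i. scaleC (c i) (f i)) summable_on I"
proof -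
  let ?g = "\<lambda>i. scaleC (c i) (f i)" and ?q = "\<lambda>i. (cmod (c i))\<^sup>2"
  have "\<exists>P. eventually P (finite_subsets_at_top I) \<and>
              (\<forall>F F'. P F \<and> P F' \<longrightarrow> dist (sum ?g F) (sum ?g F') < e)" if "e > 0" for e
  proof -
    have "(e/2)\<^sup>2 > 0" using that by simp
    then obtain F0 where F0: "finite F0" "F0 \<subseteq> I" "dist (sum ?q F0) (infsum ?q I) \<le> (e/2)\<^sup>2 / 2"
      using infsum_finite_approximation[OF c, of "(e/2)\<^sup>2 / 2"] by auto
    have tail: "norm (sum ?g F - sum ?g F0) < e / 2" if F: "finite F" "F0 \<subseteq> F" "F \<subseteq> I" for F
    proof -
      have "sum ?g F - sum ?g F0 = sum ?g (F - F0)" using F by (simp add: sum_diff)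
      then have "(norm (sum ?g F - sum ?g F0))\<^sup>2 = sum ?q (F - F0)"
        using norm_sum_orthonormal[OF on, of "F - F0" c] F by auto
      also have "\<dots> = sum ?q F - sum ?q F0" using F by (simp add: sum_diff)
      also have "\<dots> \<le> infsum ?q I - sum ?q F0"
        using finite_sum_le_infsum[OF c, of F] F by simp
      also have "\<dots> < (e/2)\<^sup>2"
        using F0(3) \<open>(e/2)\<^sup>2 > 0\<close> unfolding dist_real_def by linarith
      finally show ?thesis using \<open>e > 0\<close> by (intro power2_less_imp_less[of _ "e/2"]) auto
    qed
    show ?thesis
    proof (intro exI[of _ "\<lambda>F. finite F \<and> F0 \<subseteq> F \<and> F \<subseteq> I"] conjI allI impI)
      show "\<forall>\<^sub>F F in finite_subsets_at_top I. finite F \<and> F0 \<subseteq> F \<and> F \<subseteq> I"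
        using F0 by (auto simp: eventually_finite_subsets_at_top)
      fix F F' assume "(finite F \<and> F0 \<subseteq> F \<and> F \<subseteq> I) \<and> finite F' \<and> F0 \<subseteq> F' \<and> F' \<subseteq> I"
      then have "norm (sum ?g F - sum ?g F0) < e / 2" "norm (sum ?g F' - sum ?g F0) < e / 2"
        using tail by auto
      then show "dist (sum ?g F) (sum ?g F') < e"
        using dist_triangle2[of "sum ?g F" "sum ?g F'" "sum ?g F0"] by (simp add: dist_norm)
    qed
  qed
  then have "cauchy_filter (filtermap (sum ?g) (finite_subsets_at_top I))"
    by (simp add: cauchy_filter_metric_filtermap)
  moreover have "complete (UNIV::'a set)"
    by (meson Cauchy_convergent UNIV_I complete_def convergent_def)
  ultimately obtain L where "(sum ?g \<longlongrightarrow> L) (finite_subsets_at_top I)"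
    using complete_uniform[where S=UNIV] by (force simp add: filterlim_def)
  then show ?thesis using summable_on_def has_sum_def by blast
qed

lemma cinner_infsum_orthonormal:
  fixes f :: "'i \<Rightarrow> 'a::complex_hilbert_space"
  assumes on: "orthonormal I f" and c: "(\<lambda>i. (cmod (c i))\<^sup>2) summable_on I" and j: "j \<in> I"
  shows "cinner (\<Sum>\<^sub>\<infinity>i\<in>I. scaleC (c i) (f i)) (f j) = c j"
proof -
  have "((\<lambda>i. cinner (scaleC (c i) (f i)) (f j)) has_sum
      cinner (\<Sum>\<^sub>\<infinity>i\<in>I. scaleC (c i) (f i)) (f j)) I"
    by (intro has_sum_bounded_linear[OF bounded_linear_cinner_left] has_sum_infsum Riesz_Fischer on c)
  moreover have "((\<lambda>i. cinner (scaleC (c i) (f i)) (f j)) has_sum c j) I"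
    by (rule has_sum_finite_neutralI[of "{j}"])
       (use j on in \<open>auto simp: cinner_scaleC_left orthonormalD\<close>)
  ultimately show ?thesis by (rule has_sum_unique)
qed

lemma norm_infsum_orthonormal:
  fixes f :: "'i \<Rightarrow> 'a::complex_hilbert_space"
  assumes on: "orthonormal I f" and c: "(\<lambda>i. (cmod (c i))\<^sup>2) summable_on I"
  shows "(norm (\<Sum>\<^sub>\<infinity>i\<in>I. scaleC (c i) (f i)))\<^sup>2 = (\<Sum>\<^sub>\<infinity>i\<in>I. (cmod (c i))\<^sup>2)"
proof -
  let ?x = "\<Sum>\<^sub>\<infinity>i\<in>I. scaleC (c i) (f i)"
  have "((\<lambda>i. cinner (scaleC (c i) (f i)) ?x) has_sum cinner ?x ?x) I"
    by (intro has_sum_bounded_linear[OF bounded_linear_cinner_left] has_sum_infsum Riesz_Fischer on c)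
  moreover have "cinner (scaleC (c i) (f i)) ?x = complex_of_real ((cmod (c i))\<^sup>2)" if "i \<in> I" for i
    using cinner_infsum_orthonormal[OF on c that] cinner_commute[of "f i" ?x]
    by (simp add: cinner_scaleC_left complex_norm_square del: of_real_power)
  ultimately have "((\<lambda>i. complex_of_real ((cmod (c i))\<^sup>2)) has_sum complex_of_real ((norm ?x)\<^sup>2)) I"
    unfolding cinner_self by (simp cong: has_sum_cong del: of_real_power)
  then show ?thesis by (simp only: has_sum_of_real_iff infsumI)
qed


section \<open>Orthonormal bases\<close>

lemma orthonormal_basis_orthonormal: "orthonormal_basis I f \<Longrightarrow> orthonormal I f"
  by (simp add: orthonormal_basis_def orthonormal_def)

text \<open>The set of vectors on which two bounded linear maps agree is a closed subspace, so it is
  everything as soon as it contains a basis. This is how operators are compared below.\<close>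

lemma eq_on_basis_imp_eq:
  fixes f :: "'i \<Rightarrow> 'a::complex_hilbert_space" and A B :: "'a \<Rightarrow> 'b::real_normed_vector"
  assumes basis: "orthonormal_basis I f"
    and A: "bounded_linear A" and B: "bounded_linear B"
    and eq: "\<And>i c. i \<in> I \<Longrightarrow> A (scaleC c (f i)) = B (scaleC c (f i))"
  shows "A x = B x"
proof -
  interpret A: bounded_linear A by fact
  interpret B: bounded_linear B by fact
  have span: "A y = B y" if "y \<in> cspan (f ` I)" for y
    using that
  proof (induction rule: complex_vector.span_induct_alt)
    case (step c v z) then show ?case using eq by (auto simp: A.add B.add)
  qed (simp add: A.zero B.zero)
  have "closed {y. A y = B y}"
    by (intro closed_Collect_eq A.continuous_on B.continuous_on continuous_on_id)
  moreover have "cspan (f ` I) \<subseteq> {y. A y = B y}" using span by auto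
  ultimately have "closure (cspan (f ` I)) \<subseteq> {y. A y = B y}" by (intro closure_minimal)
  then show ?thesis using basis by (auto simp: orthonormal_basis_def)
qed

lemma eq_zero_if_orthogonal_to_basis:
  assumes "orthonormal_basis I f" "\<And>i. i \<in> I \<Longrightarrow> cinner x (f i) = 0"
  shows "x = 0"
proof (rule eq_zero_if_cinner_zero)
  fix y
  show "cinner x y = 0"
    using eq_on_basis_imp_eq[OF assms(1) bounded_linear_cinner_right[of x] bounded_linear_zero]
      assms(2) by (auto simp: cinner_scaleC_right)
qed

lemma orthonormal_basis_expansion:
  assumes "orthonormal_basis I (f :: 'i \<Rightarrow> 'a::complex_hilbert_space)"
  shows "((\<lambda>i. scaleC (cinner x (f i)) (f i)) has_sum x) I"
proof -
  note on = orthonormal_basis_orthonormal[OF assms]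
  note s = Bessel_summable[OF on, of x]
  let ?p = "\<Sum>\<^sub>\<infinity>i\<in>I. scaleC (cinner x (f i)) (f i)"
  have "x - ?p = 0"
    by (rule eq_zero_if_orthogonal_to_basis[OF assms])
       (simp add: cinner_diff_left cinner_infsum_orthonormal[OF on s])
  then show ?thesis using has_sum_infsum[OF Riesz_Fischer[OF on s]] by simp
qed

lemma Parseval:
  assumes "orthonormal_basis I (f :: 'i \<Rightarrow> 'a::complex_hilbert_space)"
  shows "((\<lambda>i. cinner x (f i) * cinner (f i) y) has_sum cinner x y) I"
  using has_sum_bounded_linear[OF bounded_linear_cinner_left orthonormal_basis_expansion[OF assms, of x], of y]
  by (simp add: cinner_scaleC_left)

lemma Parseval_norm:
  assumes "orthonormal_basis I (f :: 'i \<Rightarrow> 'a::complex_hilbert_space)"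
  shows "((\<lambda>i. (cmod (cinner x (f i)))\<^sup>2) has_sum (norm x)\<^sup>2) I"
proof -
  have "((\<lambda>i. complex_of_real ((cmod (cinner x (f i)))\<^sup>2)) has_sum complex_of_real ((norm x)\<^sup>2)) I"
    using Parseval[OF assms, of x x]
    by (simp add: cinner_self complex_norm_square cinner_commute[of "f _" x] del: of_real_power)
  then show ?thesis by (simp only: has_sum_of_real_iff)
qed

text \<open>Bessel for \<open>x\<close> and for \<open>y\<close>, combined by Cauchy-Schwarz for finite sums. This is the estimate behind
  the absolute convergence of traces.\<close>

lemma Bessel_Cauchy_Schwarz:
  assumes "orthonormal I (f :: 'i \<Rightarrow> 'a::complex_hilbert_space)"
  shows "(\<lambda>i. cmod (cinner x (f i)) * cmod (cinner (f i) y)) summable_on I"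
    "(\<Sum>\<^sub>\<infinity>i\<in>I. cmod (cinner x (f i)) * cmod (cinner (f i) y)) \<le> norm x * norm y"
proof -
  let ?h = "\<lambda>i. cmod (cinner x (f i)) * cmod (cinner (f i) y)"
  have fin: "sum ?h F \<le> norm x * norm y" if F: "finite F" "F \<subseteq> I" for F
  proof -
    have "sum ?h F \<le> L2_set (\<lambda>i. cmod (cinner x (f i))) F * L2_set (\<lambda>i. cmod (cinner (f i) y)) F"
      using L2_set_mult_ineq[of "\<lambda>i. cmod (cinner x (f i))" "\<lambda>i. cmod (cinner (f i) y)" F] by simp
    also have "\<dots> \<le> norm x * norm y"
    proof (intro mult_mono)
      show "L2_set (\<lambda>i. cmod (cinner x (f i))) F \<le> norm x"
        unfolding L2_set_def using Bessel_finite[OF assms F, of x] by (intro real_le_lsqrt) auto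
      have "cmod (cinner (f i) y) = cmod (cinner y (f i))" for i
        by (metis cinner_commute complex_mod_cnj)
      then show "L2_set (\<lambda>i. cmod (cinner (f i) y)) F \<le> norm y"
        unfolding L2_set_def using Bessel_finite[OF assms F, of y] by (intro real_le_lsqrt) auto
    qed (auto simp: L2_set_nonneg)
    finally show ?thesis .
  qed
  show "?h summable_on I"
    using fin
    by (intro nonneg_bounded_partial_sums_imp_summable_on[where C = "norm x * norm y"])
       (auto intro!: eventually_finite_subsets_at_top_weakI)
  then show "infsum ?h I \<le> norm x * norm y" using fin by (intro infsum_le_finite_sums) auto
qed


section \<open>Singular value decomposition on a finite-dimensional subspace\<close>

text \<open>A finite sum of compact discs. It serves both for the maximization below and for the compactness of operators.\<close>

lemma compact_coefficient_box:
  assumes "finite F"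
  shows "compact {\<Sum>i\<in>F. scaleC (c i) (f i :: 'a::complex_hilbert_space) |c. \<forall>i\<in>F. cmod (c i) \<le> M}"
  using assms
proof (induction F)
  case (insert a F)
  let ?K = "{\<Sum>i\<in>F. scaleC (c i) (f i) |c. \<forall>i\<in>F. cmod (c i) \<le> M}"
  let ?L = "(\<lambda>c. scaleC c (f a)) ` cball 0 M"
  have "compact ?L"
    by (intro compact_continuous_image compact_cball bounded_linear.continuous_on[OF bounded_linear_scaleC_left]
        continuous_on_id)
  then have "compact {x + y |x y. x \<in> ?L \<and> y \<in> ?K}" using insert.IH by (rule compact_sums)
  also have "{x + y |x y. x \<in> ?L \<and> y \<in> ?K} =
      {\<Sum>i\<in>insert a F. scaleC (c i) (f i) |c. \<forall>i\<in>insert a F. cmod (c i) \<le> M}" (is "?A = ?B")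
  proof safe
    fix b :: complex and c assume bc: "b \<in> cball 0 M" "\<forall>i\<in>F. cmod (c i) \<le> M"
    have "(\<Sum>i\<in>F. scaleC ((c(a := b)) i) (f i)) = (\<Sum>i\<in>F. scaleC (c i) (f i))"
      by (rule sum.cong) (use insert.hyps in auto)
    then show "\<exists>c'. scaleC b (f a) + (\<Sum>i\<in>F. scaleC (c i) (f i)) =
        (\<Sum>i\<in>insert a F. scaleC (c' i) (f i)) \<and> (\<forall>i\<in>insert a F. cmod (c' i) \<le> M)"
      using bc insert.hyps by (intro exI[of _ "c(a := b)"]) auto
  next
    fix c assume "\<forall>i\<in>insert a F. cmod (c i) \<le> M"
    then show "\<exists>x y. (\<Sum>i\<in>insert a F. scaleC (c i) (f i)) = x + y \<and> x \<in> ?L \<and> y \<in> ?K"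
      using insert.hyps
      by (intro exI[of _ "scaleC (c a) (f a)"] exI[of _ "\<Sum>i\<in>F. scaleC (c i) (f i)"]) auto
  qed
  finally show ?case .
qed simp

lemma cspan_orthonormal_expansion:
  assumes on: "orthonormal I (e :: 'i \<Rightarrow> 'a::complex_hilbert_space)" and I: "finite I"
    and x: "x \<in> cspan (e ` I)"
  shows "x = (\<Sum>i\<in>I. scaleC (cinner x (e i)) (e i))"
  using x
proof (induction rule: complex_vector.span_induct_alt)
  case (step c v z)
  then obtain j where j: "j \<in> I" "v = e j" by auto
  have "(\<Sum>i\<in>I. scaleC (cinner v (e i)) (e i)) = (\<Sum>i\<in>I. if i = j then e j else 0)"
    by (rule sum.cong) (use j on in \<open>auto simp: orthonormalD scaleC_one\<close>)
  also have "\<dots> = v" using I j by simp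
  finally have v: "(\<Sum>i\<in>I. scaleC (cinner v (e i)) (e i)) = v" .
  have "(\<Sum>i\<in>I. scaleC (cinner (scaleC c v + z) (e i)) (e i)) =
      (\<Sum>i\<in>I. scaleC c (scaleC (cinner v (e i)) (e i)) + scaleC (cinner z (e i)) (e i))"
    by (simp add: cinner_add_left cinner_scaleC_left scaleC_add_left scaleC_scaleC)
  also have "\<dots> = scaleC c v + z"
    by (simp only: sum.distrib complex_vector.scale_sum_right[symmetric] v step(2)[symmetric])
  finally show ?case by simp
qed simp

lemma sum_in_cspan:
  "F \<subseteq> I \<Longrightarrow> (\<Sum>i\<in>F. scaleC (c i) (e i)) \<in> cspan (e ` I)"
  by (intro complex_vector.span_sum complex_vector.span_scale complex_vector.span_base) auto

text \<open>First-order optimality: if \<open>(T w, T u) \<noteq> 0\<close>, moving \<open>u\<close> slightly in the direction \<open>w\<close> increases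
  \<open>\<parallel>T u\<parallel>\<^sup>2\<close> to first order, but \<open>\<parallel>u\<parallel>\<^sup>2\<close> only to second order.\<close>

lemma orthogonal_to_maximizer:
  fixes T :: "'a::complex_hilbert_space \<Rightarrow> 'a"
  assumes T: "bounded_clinear T" and u: "norm u = 1"
    and max: "\<And>c. norm (T (u + scaleC c w)) \<le> norm (T u) * norm (u + scaleC c w)"
    and orth: "cinner w u = 0"
  shows "cinner (T w) (T u) = 0"
proof (rule ccontr)
  define a where "a = cinner (T w) (T u)"
  assume "\<not> ?thesis"
  then have a: "cmod a > 0" by (simp add: a_def)
  \<comment> \<open>The phase of \<open>c\<close> makes the first-order gain real; dividing by \<open>C\<close>, which dominates the
    second-order loss, makes \<open>c\<close> small enough for the gain to win.\<close>
  define C where "C = (norm (T u))\<^sup>2 * (norm w)\<^sup>2 + 1"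
  have C: "C > 0" by (simp add: C_def add_nonneg_pos)
  define c where "c = cnj a / complex_of_real C"
  have uw: "cinner u w = 0" using orth cinner_commute[of u w] by simp
  have 1: "(norm (u + scaleC c w))\<^sup>2 = 1 + (cmod c)\<^sup>2 * (norm w)\<^sup>2"
    by (simp add: norm_add_square u cinner_scaleC_right uw power_mult_distrib)
  have "cnj c * cnj a = complex_of_real ((cmod a)\<^sup>2 / C)"
    by (simp add: c_def complex_norm_square[symmetric] mult.commute[of a])
  then have 2: "(norm (T (u + scaleC c w)))\<^sup>2 =
      (norm (T u))\<^sup>2 + (cmod c)\<^sup>2 * (norm (T w))\<^sup>2 + 2 * ((cmod a)\<^sup>2 / C)"
    using cinner_commute[of "T u" "T w"]
    by (simp add: bounded_clinearD[OF T] norm_add_square cinner_scaleC_right power_mult_distrib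
        flip: a_def)
  have "(norm (T (u + scaleC c w)))\<^sup>2 \<le> (norm (T u))\<^sup>2 * (norm (u + scaleC c w))\<^sup>2"
    using max[of c] by (metis norm_ge_zero power_mono power_mult_distrib)
  then have "2 * ((cmod a)\<^sup>2 / C) \<le> (cmod c)\<^sup>2 * ((norm (T u))\<^sup>2 * (norm w)\<^sup>2) - (cmod c)\<^sup>2 * (norm (T w))\<^sup>2"
    unfolding 1 2 by (simp add: algebra_simps)
  also have "\<dots> \<le> (cmod c)\<^sup>2 * C"
    unfolding C_def by (simp add: algebra_simps)
  also have "\<dots> = (cmod a)\<^sup>2 / C"
    using C by (simp add: c_def norm_divide power_divide power2_eq_square)
  finally show False using a C by (simp add: field_simps)
qed

text \<open>The induction carries more than pairwise orthogonality of the images: the image of \<open>f\<^sub>i\<close> has to be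
  orthogonal to the image of the whole complement of \<open>f\<^sub>i\<close>, which is what a maximizer provides and what
  makes the later choices compatible with the earlier ones.\<close>

lemma SVD_greedy:
  fixes T :: "'a::complex_hilbert_space \<Rightarrow> 'a"
  assumes on: "orthonormal I e" and I: "finite I" and T: "bounded_clinear T"
    and k: "k \<le> card I"
  shows "\<exists>f :: nat \<Rightarrow> 'a. orthonormal {..<k} f \<and> f ` {..<k} \<subseteq> cspan (e ` I) \<and>
    (\<forall>i<k. \<forall>w\<in>cspan (e ` I). cinner w (f i) = 0 \<longrightarrow> cinner (T w) (T (f i)) = 0)"
  using k
proof (induction k)
  case 0 then show ?case by (auto simp: orthonormal_def)
next
  case (Suc k)
  let ?V = "cspan (e ` I)"
  from Suc obtain f where f: "orthonormal {..<k} f" "f ` {..<k} \<subseteq> ?V"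
    "\<And>i w. i < k \<Longrightarrow> w \<in> ?V \<Longrightarrow> cinner w (f i) = 0 \<Longrightarrow> cinner (T w) (T (f i)) = 0"
    by auto
  define W where "W = {w \<in> ?V. \<forall>i<k. cinner w (f i) = 0}"
  define p where "p v = (\<Sum>i<k. scaleC (cinner v (f i)) (f i))" for v
  have p_V: "p v \<in> ?V" for v
    unfolding p_def using f(2)
    by (intro complex_vector.span_sum complex_vector.span_scale) auto
  have W_diff: "v - p v \<in> W" if "v \<in> ?V" for v
    using that p_V[of v] cinner_sum_orthonormal[OF f(1), of "{..<k}" _ "\<lambda>i. cinner v (f i)"]
    by (auto simp: W_def p_def cinner_diff_left intro: complex_vector.span_diff)
  have W_scale: "scaleC c w \<in> W" if "w \<in> W" for c w
    using that by (auto simp: W_def cinner_scaleC_left intro: complex_vector.span_scale)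
  have W_add: "v + w \<in> W" if "v \<in> W" "w \<in> W" for v w
    using that by (auto simp: W_def cinner_add_left intro: complex_vector.span_add)
  \<comment> \<open>\<open>W\<close> is nonzero because \<open>k\<close> vectors cannot span the space of the \<open>card I > k\<close> independent \<open>e\<^sub>i\<close>.\<close>
  have "\<exists>w\<in>W. w \<noteq> 0"
  proof (rule ccontr)
    assume "\<not> ?thesis"
    then have "v = p v" if "v \<in> ?V" for v using W_diff[OF that] by auto
    moreover have "p v \<in> cspan (f ` {..<k})" for v
      unfolding p_def by (rule sum_in_cspan) simp
    ultimately have "e ` I \<subseteq> cspan (f ` {..<k})"
      by (metis complex_vector.span_superset subset_iff)
    from complex_vector.independent_span_bound[OF _ orthonormal_independent[OF on] this]
    have "card (e ` I) \<le> card (f ` {..<k})" by simp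
    also have "\<dots> \<le> k" using card_image_le[of "{..<k}" f] by simp
    finally show False using Suc.prems by (simp add: card_image orthonormal_inj_on[OF on])
  qed
  then obtain w0 where w0: "w0 \<in> W" "w0 \<noteq> 0" by blast
  define K where "K = {w \<in> W. norm w = 1}"
  have "scaleC (1 / norm w0) w0 \<in> K" using w0 by (auto simp: K_def W_scale norm_divide)
  moreover have "compact K"
  proof -
    let ?B = "{\<Sum>i\<in>I. scaleC (c i) (e i) |c. \<forall>i\<in>I. cmod (c i) \<le> 1}"
    have "w \<in> ?B" if "w \<in> ?V" "norm w = 1" for w
    proof -
      have "cmod (cinner w (e i)) \<le> 1" if "i \<in> I" for i
        using Cauchy_Schwarz[of w "e i"] \<open>norm w = 1\<close> orthonormal_norm[OF on that] by simp
      then show ?thesis using cspan_orthonormal_expansion[OF on I \<open>w \<in> ?V\<close>]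
        by (intro CollectI exI[of _ "\<lambda>i. cinner w (e i)"]) simp
    qed
    moreover have "?B \<subseteq> ?V" using sum_in_cspan[of I I] by auto
    ultimately have K: "K = ?B \<inter> ((\<Inter>i\<in>{..<k}. {w. cinner w (f i) = 0}) \<inter> {w. norm w = 1})"
      by (fastforce simp: K_def W_def)
    have "closed ((\<Inter>i\<in>{..<k}. {w. cinner w (f i) = 0}) \<inter> {w. norm w = 1})"
      by (intro closed_Int closed_INT ballI closed_Collect_eq continuous_intros
          bounded_linear.continuous_on[OF bounded_linear_cinner_left])
    then show ?thesis by (simp only: K compact_Int_closed[OF compact_coefficient_box[OF I]])
  qed
  moreover have "continuous_on K (\<lambda>w. norm (T w))"
    by (intro continuous_intros bounded_linear.continuous_on[OF bounded_clinearD(1)[OF T]])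
  ultimately obtain u where u: "u \<in> K" "\<And>w. w \<in> K \<Longrightarrow> norm (T w) \<le> norm (T u)"
    using continuous_attains_sup[of K "\<lambda>w. norm (T w)"] by blast
  then have uW: "u \<in> W" and u1: "norm u = 1" by (auto simp: K_def)
  have max: "norm (T w) \<le> norm (T u) * norm w" if "w \<in> W" for w
  proof (cases "w = 0")
    case False
    then have "scaleC (1 / norm w) w \<in> K" using that by (auto simp: K_def W_scale norm_divide)
    from u(2)[OF this] False show ?thesis
      by (simp add: bounded_clinearD[OF T] norm_divide field_simps)
  qed (simp add: bounded_clinearD[OF T])
  \<comment> \<open>Split \<open>w\<close> into its component in \<open>W\<close>, handled by maximality of \<open>u\<close>, and the projection to the earlier
    \<open>f\<^sub>i\<close>, handled by the induction hypothesis applied to \<open>u\<close>.\<close>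
  have Tu: "cinner (T w) (T u) = 0" if w: "w \<in> ?V" "cinner w u = 0" for w
  proof -
    have fu: "cinner (f i) u = 0" if "i < k" for i
      using that uW cinner_commute[of "f i" u] by (simp add: W_def)
    have Tfu: "cinner (T (f i)) (T u) = 0" if "i < k" for i
      using f(3)[OF that, of u] uW that cinner_commute[of "T (f i)" "T u"] by (simp add: W_def)
    have "cinner (T (w - p w)) (T u) = 0"
    proof (rule orthogonal_to_maximizer[OF T u1 max])
      show "u + scaleC c (w - p w) \<in> W" for c by (intro W_add uW W_scale W_diff w)
      show "cinner (w - p w) u = 0"
        using fu by (simp add: cinner_diff_left w p_def cinner_sum_left cinner_scaleC_left)
    qed
    moreover have "cinner (T (p w)) (T u) = 0"
      using Tfu by (simp add: p_def bounded_clinearD[OF T] cinner_sum_left cinner_scaleC_left)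
    ultimately show ?thesis by (simp add: bounded_clinearD[OF T] cinner_diff_left)
  qed
  show ?case
  proof (intro exI[of _ "f(k := u)"] conjI)
    have "cinner u u = 1" using u1 by (simp add: cinner_self)
    moreover have "cinner u (f i) = 0" "cinner (f i) u = 0" if "i < k" for i
      using uW that cinner_commute[of "f i" u] by (auto simp: W_def)
    ultimately show "orthonormal {..<Suc k} (f(k := u))"
      using f(1) by (auto simp: orthonormal_def less_Suc_eq)
    show "(f(k := u)) ` {..<Suc k} \<subseteq> ?V" using f(2) uW by (auto simp: W_def less_Suc_eq)
    show "\<forall>i<Suc k. \<forall>w\<in>?V. cinner w ((f(k := u)) i) = 0 \<longrightarrow> cinner (T w) (T ((f(k := u)) i)) = 0"
      using f(3) Tu by (auto simp: less_Suc_eq)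
  qed
qed

lemma SVD_finite_dimensional:
  fixes T :: "'a::complex_hilbert_space \<Rightarrow> 'a"
  assumes on: "orthonormal I e" and I: "finite I" and T: "bounded_clinear T"
  obtains f :: "nat \<Rightarrow> 'a" where "orthonormal {..<card I} f" "f ` {..<card I} \<subseteq> cspan (e ` I)"
    "\<And>i j. i < card I \<Longrightarrow> j < card I \<Longrightarrow>
       cinner (T (f i)) (T (f j)) = (if i = j then complex_of_real ((norm (T (f i)))\<^sup>2) else 0)"
proof -
  obtain f where f: "orthonormal {..<card I} f" "f ` {..<card I} \<subseteq> cspan (e ` I)"
    "\<And>i w. i < card I \<Longrightarrow> w \<in> cspan (e ` I) \<Longrightarrow> cinner w (f i) = 0 \<Longrightarrow> cinner (T w) (T (f i)) = 0"
    using SVD_greedy[OF assms order_refl] by auto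
  show thesis
    by (rule that[OF f(1,2)]) (use f in \<open>auto simp: cinner_self orthonormalD intro!: f(3)\<close>)
qed


section \<open>Operators defined by their coefficients, and adjoints\<close>

text \<open>An operator is determined by its coefficients with respect to an orthonormal family, and by
  Riesz-Fischer it exists as soon as these are linear and square-summable with a uniform bound. The
  adjoint and the absolute value are both built this way.\<close>

lemma coefficient_operator:
  fixes f :: "'i \<Rightarrow> 'a::complex_hilbert_space" and c :: "'a \<Rightarrow> 'i \<Rightarrow> complex"
  assumes on: "orthonormal I f"
    and add: "\<And>x y i. i \<in> I \<Longrightarrow> c (x + y) i = c x i + c y i"
    and scale: "\<And>a x i. i \<in> I \<Longrightarrow> c (scaleC a x) i = a * c x i"
    and bound: "\<And>x F. finite F \<Longrightarrow> F \<subseteq> I \<Longrightarrow> (\<Sum>i\<in>F. (cmod (c x i))\<^sup>2) \<le> (M * norm x)\<^sup>2"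
    and M: "0 \<le> M"
  obtains D where "bounded_clinear D" "\<And>x i. i \<in> I \<Longrightarrow> cinner (D x) (f i) = c x i"
proof -
  define D where "D x = (\<Sum>\<^sub>\<infinity>i\<in>I. scaleC (c x i) (f i))" for x
  have l2: "(\<lambda>i. (cmod (c x i))\<^sup>2) summable_on I" for x
    using bound
    by (intro nonneg_bounded_partial_sums_imp_summable_on[where C = "(M * norm x)\<^sup>2"])
       (auto intro!: eventually_finite_subsets_at_top_weakI)
  have D: "((\<lambda>i. scaleC (c x i) (f i)) has_sum D x) I" for x
    unfolding D_def by (intro has_sum_infsum Riesz_Fischer on l2)
  have D_add: "D (x + y) = D x + D y" for x y
  proof -
    have "((\<lambda>i. scaleC (c (x + y) i) (f i)) has_sum D x + D y) I"
      using has_sum_add[OF D[of x] D[of y]]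
      by (rule has_sum_cong[THEN iffD1, rotated]) (simp add: add scaleC_add_left)
    then show ?thesis using D[of "x + y"] has_sum_unique by blast
  qed
  have D_scale: "D (scaleC a x) = scaleC a (D x)" for a x
  proof -
    have "((\<lambda>i. scaleC (c (scaleC a x) i) (f i)) has_sum scaleC a (D x)) I"
      using has_sum_bounded_linear[OF bounded_linear_scaleC D, of a x]
      by (rule has_sum_cong[THEN iffD1, rotated]) (simp add: scale scaleC_scaleC)
    then show ?thesis using D[of "scaleC a x"] has_sum_unique by blast
  qed
  have "norm (D x) \<le> norm x * M" for x
  proof -
    have "(norm (D x))\<^sup>2 = (\<Sum>\<^sub>\<infinity>i\<in>I. (cmod (c x i))\<^sup>2)"
      unfolding D_def by (rule norm_infsum_orthonormal[OF on l2])
    also have "\<dots> \<le> (M * norm x)\<^sup>2" by (intro infsum_le_finite_sums l2 bound)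
    finally have "norm (D x) \<le> M * norm x" by (rule power2_le_imp_le) (simp add: M)
    then show ?thesis by (simp add: mult.commute)
  qed
  then have "bounded_linear D"
    by (intro bounded_linear_intro[where K = M]) (auto simp: D_add D_scale scaleR_scaleC)
  then have "bounded_clinear D" by (simp add: bounded_clinear_def D_scale)
  then show thesis
    by (rule that) (simp add: D_def cinner_infsum_orthonormal[OF on l2])
qed

lemma bounded_clinear_norm_bound:
  assumes "bounded_clinear (T :: 'a::complex_hilbert_space \<Rightarrow> 'a)"
  obtains M where "0 < M" "\<And>x. norm (T x) \<le> M * norm x"
  using bounded_linear.pos_bounded[OF bounded_clinearD(1)[OF assms]] by (metis mult.commute)

text \<open>With \<open>z = \<Sum>\<^bsub>i\<in>F\<^esub> (x, T f\<^sub>i) f\<^sub>i\<close> one has \<open>\<parallel>z\<parallel>\<^sup>2 = (x, T z) \<le> M \<parallel>x\<parallel> \<parallel>z\<parallel>\<close>, which bounds the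
  coefficients \<open>(x, T f\<^sub>i)\<close> that the adjoint must have.\<close>

lemma adjoint_exists:
  fixes f :: "'i \<Rightarrow> 'a::complex_hilbert_space" and T :: "'a \<Rightarrow> 'a"
  assumes basis: "orthonormal_basis I f" and T: "bounded_clinear T"
  obtains S where "bounded_clinear S" "\<And>x y. cinner (T x) y = cinner x (S y)"
proof -
  note on = orthonormal_basis_orthonormal[OF basis]
  obtain M where M: "0 < M" "\<And>x. norm (T x) \<le> M * norm x"
    using bounded_clinear_norm_bound[OF T] by auto
  have bound: "(\<Sum>i\<in>F. (cmod (cinner x (T (f i))))\<^sup>2) \<le> (M * norm x)\<^sup>2"
    if F: "finite F" "F \<subseteq> I" for F x
  proof -
    define z where "z = (\<Sum>i\<in>F. scaleC (cinner x (T (f i))) (f i))"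
    have z2: "(norm z)\<^sup>2 = (\<Sum>i\<in>F. (cmod (cinner x (T (f i))))\<^sup>2)"
      unfolding z_def by (rule norm_sum_orthonormal[OF on F])
    have "cinner x (T z) = (\<Sum>i\<in>F. cnj (cinner x (T (f i))) * cinner x (T (f i)))"
      by (simp add: z_def bounded_clinearD[OF T] cinner_sum_right cinner_scaleC_right)
    also have "\<dots> = complex_of_real ((norm z)\<^sup>2)"
      by (simp add: z2 complex_norm_square mult.commute del: of_real_power)
    finally have "(norm z)\<^sup>2 = cmod (cinner x (T z))" by (simp add: norm_power)
    also have "\<dots> \<le> norm x * (M * norm z)"
      using Cauchy_Schwarz[of x "T z"] M(2)[of z] by (meson mult_left_mono norm_ge_zero order_trans)
    finally have "norm z * norm z \<le> (M * norm x) * norm z"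
      by (simp add: power2_eq_square mult_ac)
    then have "norm z \<le> M * norm x"
      using M(1) by (cases "norm z = 0") (auto simp: mult_le_cancel_right)
    then show ?thesis unfolding z2[symmetric] by (simp add: power_mono)
  qed
  obtain S where S: "bounded_clinear S" "\<And>x i. i \<in> I \<Longrightarrow> cinner (S x) (f i) = cinner x (T (f i))"
    by (rule coefficient_operator[OF on, of "\<lambda>x i. cinner x (T (f i))" M])
       (use bound M in \<open>auto simp: cinner_add_left cinner_scaleC_left\<close>)
  have "cinner (T x) y = cinner x (S y)" for x y
  proof (rule eq_on_basis_imp_eq[OF basis, where A = "\<lambda>x. cinner (T x) y" and B = "\<lambda>x. cinner x (S y)"])
    show "bounded_linear (\<lambda>x. cinner (T x) y)"
      using bounded_linear_compose[OF bounded_linear_cinner_left bounded_clinearD(1)[OF T]] .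
    show "bounded_linear (\<lambda>x. cinner x (S y))" by (rule bounded_linear_cinner_left)
    fix i c assume "i \<in> I"
    then have "cinner (T (f i)) y = cinner (f i) (S y)"
      using S(2)[of i y] by (metis cinner_commute)
    then show "cinner (T (scaleC c (f i))) y = cinner (scaleC c (f i)) (S y)"
      by (simp add: bounded_clinearD[OF T] cinner_scaleC_left)
  qed
  with S(1) show thesis by (rule that)
qed

lemma adjoint_op:
  fixes f :: "'i \<Rightarrow> 'a::complex_hilbert_space" and T :: "'a \<Rightarrow> 'a"
  assumes basis: "orthonormal_basis I f" and T: "bounded_clinear T"
  shows "bounded_clinear (adjoint_op T)" "cinner (T x) y = cinner x (adjoint_op T y)"
proof -
  obtain S where S: "bounded_clinear S" "\<And>x y. cinner (T x) y = cinner x (S y)"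
    using adjoint_exists[OF assms] by auto
  have "adjoint_op T = S"
    unfolding adjoint_op_def
  proof (rule the_equality)
    fix R assume R: "\<forall>x y. cinner (T x) y = cinner x (R y)"
    show "R = S"
    proof
      fix y
      have "cinner (R y - S y) x = 0" for x
        using R S(2)[of x y] cinner_commute[of "R y - S y" x] by (simp add: cinner_diff_right)
      then show "R y = S y" using eq_zero_if_cinner_zero[of "R y - S y"] by simp
    qed
  qed (use S in blast)
  with S show "bounded_clinear (adjoint_op T)" "cinner (T x) y = cinner x (adjoint_op T y)"
    by auto
qed


section \<open>Operators with an orthogonal image of an orthonormal basis\<close>

text \<open>Put \<open>h = C x - t x\<close>. If \<open>t > 0\<close>, then \<open>C h = - t h\<close>, so positivity forces \<open>h = 0\<close>. If \<open>t = 0\<close>,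
  then \<open>C h = 0\<close> and \<open>0 \<le> (C (x - a h), x - a h) = (h, x) - a \<parallel>h\<parallel>\<^sup>2\<close> for all real \<open>a\<close>.\<close>

lemma positive_sqrt_eigenvector:
  assumes C: "positive_op C" and sq: "C (C x) = scaleC (complex_of_real (t\<^sup>2)) x" and t: "0 \<le> t"
  shows "C x = scaleC (complex_of_real t) x"
proof -
  have Cl: "bounded_clinear C" and pos: "0 \<le> cinner (C y) y" for y
    using C by (auto simp: positive_op_def)
  note Cl = bounded_clinearD[OF Cl]
  define h where "h = C x - scaleC (complex_of_real t) x"
  have Ch: "C h = scaleC (- complex_of_real t) h"
    by (simp add: h_def Cl sq complex_vector.scale_right_diff_distrib scaleC_scaleC power2_eq_square)
  have "h = 0"
  proof (cases "t = 0")
    case False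
    have "0 \<le> cinner (C h) h" by (rule pos)
    then have "t * (norm h)\<^sup>2 \<le> 0"
      unfolding Ch by (simp add: cinner_scaleC_left cinner_self less_eq_complex_def)
    then show ?thesis using False t by (simp add: mult_le_0_iff)
  next
    case True
    then have Ch0: "C h = 0" and Cx: "C x = h" using Ch by (auto simp: h_def)
    show ?thesis
    proof (rule ccontr)
      assume h: "h \<noteq> 0"
      define a where "a = (Re (cinner h x) + 1) / (norm h)\<^sup>2"
      have "0 \<le> cinner (C (x - scaleC (complex_of_real a) h)) (x - scaleC (complex_of_real a) h)"
        by (rule pos)
      also have "\<dots> = cinner h x - complex_of_real (a * (norm h)\<^sup>2)"
        by (simp add: Cl Ch0 Cx cinner_diff_right cinner_scaleC_right cinner_self)
      finally show False using h by (simp add: a_def less_eq_complex_def)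
    qed
  qed
  then show ?thesis by (simp add: h_def)
qed

text \<open>The data of a singular value decomposition, without the left singular vectors: these would be
  \<open>T f\<^sub>i / s\<^sub>i\<close>, defined only where \<open>s\<^sub>i \<noteq> 0\<close>, and orthogonality of the images says the same.\<close>

locale singular_basis =
  fixes I :: "'i set" and f :: "'i \<Rightarrow> 'a::complex_hilbert_space" and T :: "'a \<Rightarrow> 'a"
    and s :: "'i \<Rightarrow> real"
  assumes basis: "orthonormal_basis I f"
    and T: "bounded_clinear T"
    and s_nonneg: "\<And>i. i \<in> I \<Longrightarrow> 0 \<le> s i"
    and images: "\<And>i j. i \<in> I \<Longrightarrow> j \<in> I \<Longrightarrow>
      cinner (T (f i)) (T (f j)) = (if i = j then complex_of_real ((s i)\<^sup>2) else 0)"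
begin

lemmas orthonormal_f = orthonormal_basis_orthonormal[OF basis]
lemmas T_linear = bounded_clinearD[OF T]
lemmas adjoint_T = adjoint_op[OF basis T]

lemma norm_T_basis: "i \<in> I \<Longrightarrow> norm (T (f i)) = s i"
  using images[of i i] s_nonneg[of i] by (simp add: norm_eq_sqrt_cinner)

lemma eq_if_coefficients_eq: "(\<And>i. i \<in> I \<Longrightarrow> cinner x (f i) = cinner y (f i)) \<Longrightarrow> x = y"
  using eq_zero_if_orthogonal_to_basis[OF basis, of "x - y"] by (simp add: cinner_diff_left)

lemma adjoint_T_basis: "i \<in> I \<Longrightarrow> adjoint_op T (T (f i)) = scaleC (complex_of_real ((s i)\<^sup>2)) (f i)"
proof (rule eq_if_coefficients_eq)
  fix j assume "i \<in> I" "j \<in> I"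
  have "cinner (adjoint_op T (T (f i))) (f j) = cinner (T (f i)) (T (f j))"
    using adjoint_T(2)[of "f j" "T (f i)"] by (metis cinner_commute)
  then show "cinner (adjoint_op T (T (f i))) (f j) = cinner (scaleC (complex_of_real ((s i)\<^sup>2)) (f i)) (f j)"
    using \<open>i \<in> I\<close> \<open>j \<in> I\<close> by (simp add: images cinner_scaleC_left orthonormalD[OF orthonormal_f])
qed

lemma abs_op_exists:
  "\<exists>B. positive_op B \<and> B \<circ> B = adjoint_op T \<circ> T \<and> (\<forall>i\<in>I. \<forall>x. cinner (B x) (f i) = s i * cinner x (f i))"
proof -
  obtain M where M: "0 < M" "\<And>x. norm (T x) \<le> M * norm x"
    using bounded_clinear_norm_bound[OF T] by auto
  have sM: "s i \<le> M" if "i \<in> I" for i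
    using M(2)[of "f i"] that by (simp add: norm_T_basis orthonormal_norm[OF orthonormal_f])
  have "(\<Sum>i\<in>F. (cmod (s i * cinner x (f i)))\<^sup>2) \<le> (M * norm x)\<^sup>2" if F: "finite F" "F \<subseteq> I" for x F
  proof -
    have "(\<Sum>i\<in>F. (cmod (s i * cinner x (f i)))\<^sup>2) \<le> (\<Sum>i\<in>F. M\<^sup>2 * (cmod (cinner x (f i)))\<^sup>2)"
      using F sM s_nonneg
      by (intro sum_mono) (auto simp: norm_mult power_mult_distrib subset_iff intro!: mult_right_mono power_mono)
    also have "\<dots> \<le> M\<^sup>2 * (norm x)\<^sup>2"
      using Bessel_finite[OF orthonormal_f F, of x] by (simp add: sum_distrib_left[symmetric] mult_left_mono)
    finally show ?thesis by (simp add: power_mult_distrib)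
  qed
  then obtain B where B: "bounded_clinear B" "\<And>x i. i \<in> I \<Longrightarrow> cinner (B x) (f i) = s i * cinner x (f i)"
    using coefficient_operator[OF orthonormal_f, of "\<lambda>x i. s i * cinner x (f i)" M] M(1)
    by (auto simp: cinner_add_left cinner_scaleC_left algebra_simps)
  have "0 \<le> cinner (B x) x" for x
  proof -
    have sum: "((\<lambda>i. complex_of_real (s i * (cmod (cinner x (f i)))\<^sup>2)) has_sum cinner (B x) x) I"
      using Parseval[OF basis, of "B x" x]
      by (rule has_sum_cong[THEN iffD1, rotated])
         (simp add: B complex_norm_square cinner_commute[of "f _" x] mult.assoc del: of_real_power)
    have "0 \<le> Re (cinner (B x) x)"
      by (rule has_sum_nonneg[OF has_sum_Re[OF sum]]) (simp add: s_nonneg)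
    moreover have "((\<lambda>i. 0) has_sum Im (cinner (B x) x)) I"
      using has_sum_Im[OF sum] by simp
    then have "Im (cinner (B x) x) = 0"
      using has_sum_unique has_sum_0_simp by blast
    ultimately show ?thesis by (simp add: less_eq_complex_def)
  qed
  then have "positive_op B" using B by (simp add: positive_op_def)
  moreover have "B (B x) = adjoint_op T (T x)" for x
  proof (rule eq_on_basis_imp_eq[OF basis, where A = "\<lambda>x. B (B x)" and B = "\<lambda>x. adjoint_op T (T x)"])
    show "bounded_linear (\<lambda>x. B (B x))"
      using bounded_linear_compose bounded_clinearD(1)[OF B(1)] by blast
    show "bounded_linear (\<lambda>x. adjoint_op T (T x))"
      using bounded_linear_compose bounded_clinearD(1)[OF adjoint_T(1)] T_linear(1) by blast
    fix i c assume i: "i \<in> I"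
    have "B (B (f i)) = scaleC (complex_of_real ((s i)\<^sup>2)) (f i)"
      by (rule eq_if_coefficients_eq)
         (use i in \<open>auto simp: B orthonormalD[OF orthonormal_f] cinner_scaleC_left power2_eq_square\<close>)
    then show "B (B (scaleC c (f i))) = adjoint_op T (T (scaleC c (f i)))"
      using i by (simp add: bounded_clinearD[OF B(1)] T_linear bounded_clinearD[OF adjoint_T(1)] adjoint_T_basis)
  qed
  ultimately show ?thesis using B(2) by (auto simp: fun_eq_iff)
qed

text \<open>The description of \<open>|T|\<close> includes that the definite description defining it denotes: a second
  positive root agrees with the first one on every \<open>f\<^sub>i\<close>, hence everywhere.\<close>

lemma abs_op_diagonal:
  "bounded_clinear (abs_op T)"
  "abs_op T \<circ> abs_op T = adjoint_op T \<circ> T"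
  "i \<in> I \<Longrightarrow> cinner (abs_op T x) (f i) = s i * cinner x (f i)"
proof -
  obtain B where B: "positive_op B" "B \<circ> B = adjoint_op T \<circ> T"
    "\<And>i x. i \<in> I \<Longrightarrow> cinner (B x) (f i) = s i * cinner x (f i)"
    using abs_op_exists by blast
  have pos_sqrt: "C (f i) = scaleC (complex_of_real (s i)) (f i)"
    if C: "positive_op C" "C \<circ> C = adjoint_op T \<circ> T" and i: "i \<in> I" for C i
  proof (rule positive_sqrt_eigenvector[OF C(1) _ s_nonneg[OF i]])
    have "C (C (f i)) = adjoint_op T (T (f i))" using fun_cong[OF C(2), of "f i"] by simp
    then show "C (C (f i)) = scaleC (complex_of_real ((s i)\<^sup>2)) (f i)"
      by (simp only: adjoint_T_basis[OF i])
  qed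
  have "abs_op T = B"
    unfolding abs_op_def
  proof (rule the_equality)
    fix C assume C: "positive_op C \<and> C \<circ> C = adjoint_op T \<circ> T"
    then have lin: "bounded_clinear B" "bounded_clinear C" using B by (auto simp: positive_op_def)
    show "C = B"
    proof
      fix x
      show "C x = B x"
        by (rule eq_on_basis_imp_eq[OF basis, where A = C and B = B])
           (simp_all add: bounded_clinearD[OF lin(1)] bounded_clinearD[OF lin(2)] pos_sqrt C B(1,2))
    qed
  qed (use B in blast)
  with B show "bounded_clinear (abs_op T)" "abs_op T \<circ> abs_op T = adjoint_op T \<circ> T"
    "i \<in> I \<Longrightarrow> cinner (abs_op T x) (f i) = s i * cinner x (f i)"
    by (auto simp: positive_op_def)
qed

lemma norm_T_square: "((\<lambda>i. (s i)\<^sup>2 * (cmod (cinner x (f i)))\<^sup>2) has_sum (norm (T x))\<^sup>2) I"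
proof -
  have "cinner (T x) (T x) = cnj (cinner (adjoint_op T (T x)) x)"
    using adjoint_T(2)[of x "T x"] cinner_commute by metis
  moreover have "adjoint_op T (T x) = abs_op T (abs_op T x)"
    using abs_op_diagonal(2) by (metis comp_apply)
  ultimately have *: "cinner (abs_op T (abs_op T x)) x = complex_of_real ((norm (T x))\<^sup>2)"
    by (metis cinner_self complex_cnj_cnj complex_cnj_complex_of_real)
  have "((\<lambda>i. complex_of_real ((s i)\<^sup>2 * (cmod (cinner x (f i)))\<^sup>2)) has_sum
      complex_of_real ((norm (T x))\<^sup>2)) I"
    using Parseval[OF basis, of "abs_op T (abs_op T x)" x] unfolding *
    by (rule has_sum_cong[THEN iffD1, rotated])
       (simp add: abs_op_diagonal complex_norm_square cinner_commute[of "f _" x]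
          power2_eq_square[of "s _"] mult_ac del: of_real_power)
  then show ?thesis by (simp only: has_sum_of_real_iff)
qed


subsection \<open>Eigenspaces of the absolute value\<close>

lemma mem_eigenspace_iff:
  "x \<in> eigenspace_op (abs_op T) (complex_of_real t) \<longleftrightarrow> (\<forall>i\<in>I. s i \<noteq> t \<longrightarrow> cinner x (f i) = 0)"
proof -
  have "abs_op T x = scaleC (complex_of_real t) x \<longleftrightarrow>
      (\<forall>i\<in>I. s i * cinner x (f i) = t * cinner x (f i))"
    by (metis abs_op_diagonal(3) cinner_scaleC_left eq_if_coefficients_eq)
  then show ?thesis by (auto simp: eigenspace_op_def)
qed

text \<open>Both sides are 0 if infinitely many \<open>s\<^sub>i\<close> equal \<open>t\<close>: the right one because the set is infinite, the
  left one because a Hamel basis of the eigenspace extending \<open>{f\<^sub>i. s\<^sub>i = t}\<close> is then infinite.\<close>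

lemma cdim_eigenspace:
  "cdim (eigenspace_op (abs_op T) (complex_of_real t)) = card {i \<in> I. s i = t}"
proof -
  let ?F = "{i \<in> I. s i = t}" and ?E = "eigenspace_op (abs_op T) (complex_of_real t)"
  have onF: "orthonormal ?F f" by (rule orthonormal_subset[OF orthonormal_f]) auto
  have card: "card (f ` ?F) = card ?F" by (rule card_image[OF orthonormal_inj_on[OF onF]])
  have sub: "f ` ?F \<subseteq> ?E"
    by (auto simp: mem_eigenspace_iff orthonormalD[OF orthonormal_f])
  note ind = orthonormal_independent[OF onF]
  show ?thesis
  proof (cases "finite ?F")
    case True
    have "?E \<subseteq> cspan (f ` ?F)"
    proof
      fix x assume x: "x \<in> ?E"
      have "((\<lambda>i. scaleC (cinner x (f i)) (f i)) has_sum (\<Sum>i\<in>?F. scaleC (cinner x (f i)) (f i))) I"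
        by (rule has_sum_finite_neutralI[OF True]) (use x in \<open>auto simp: mem_eigenspace_iff\<close>)
      then have eq: "x = (\<Sum>i\<in>?F. scaleC (cinner x (f i)) (f i))"
        by (rule has_sum_unique[OF orthonormal_basis_expansion[OF basis]])
      show "x \<in> cspan (f ` ?F)" by (subst eq) (rule sum_in_cspan[OF order_refl])
    qed
    then show ?thesis using complex_vector.dim_unique[OF sub _ ind card] by simp
  next
    case False
    obtain B where B: "f ` ?F \<subseteq> B" "B \<subseteq> ?E" "complex_vector.independent B" "?E \<subseteq> cspan B"
      using complex_vector.maximal_independent_subset_extend[OF sub ind] by blast
    have "infinite B"
      using B(1) False finite_subset finite_image_iff[OF orthonormal_inj_on[OF onF]] by blast
    then show ?thesis
      using complex_vector.basis_card_eq_dim[OF B(2,4,3)] False by simp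
  qed
qed


subsection \<open>Compactness\<close>

text \<open>Distinct \<open>i, j\<close> with \<open>s\<^sub>i, s\<^sub>j \<ge> \<epsilon>\<close> have \<open>\<parallel>T f\<^sub>i - T f\<^sub>j\<parallel>\<^sup>2 = s\<^sub>i\<^sup>2 + s\<^sub>j\<^sup>2 \<ge> 2 \<epsilon>\<^sup>2\<close>, so infinitely many of
  them cannot be covered by finitely many balls of radius \<open>\<epsilon>/2\<close>.\<close>

lemma compact_op_imp_finite:
  assumes "compact_op T" "0 < \<epsilon>"
  shows "finite {i \<in> I. \<epsilon> \<le> s i}"
proof (rule ccontr)
  let ?G = "{i \<in> I. \<epsilon> \<le> s i}"
  assume inf: "infinite ?G"
  have "compact (closure (T ` cball 0 1))" using assms by (simp add: compact_op_def)
  then obtain K where K: "finite K" "closure (T ` cball 0 1) \<subseteq> (\<Union>x\<in>K. ball x (\<epsilon>/2))"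
    using \<open>0 < \<epsilon>\<close> unfolding compact_eq_totally_bounded by (meson half_gt_zero)
  have "\<exists>x\<in>K. T (f i) \<in> ball x (\<epsilon>/2)" if "i \<in> ?G" for i
  proof -
    have "T (f i) \<in> T ` cball 0 1" using that by (auto simp: orthonormal_norm[OF orthonormal_f])
    then have "T (f i) \<in> (\<Union>x\<in>K. ball x (\<epsilon>/2))" by (rule subsetD[OF K(2) subsetD[OF closure_subset]])
    then show ?thesis by blast
  qed
  then obtain p where p: "\<And>i. i \<in> ?G \<Longrightarrow> p i \<in> K \<and> T (f i) \<in> ball (p i) (\<epsilon>/2)" by metis
  have "finite (p ` ?G)" using p K(1) by (meson finite_subset image_subsetI)
  then have "\<not> inj_on p ?G" using inf finite_imageD by blast
  then obtain i j where ij: "i \<in> ?G" "j \<in> ?G" "p i = p j" "i \<noteq> j" by (auto simp: inj_on_def)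
  have "dist (T (f i)) (T (f j)) < \<epsilon>"
  proof (rule dist_triangle_half_r)
    show "dist (p i) (T (f i)) < \<epsilon>/2" using p[OF ij(1)] by simp
    show "dist (p i) (T (f j)) < \<epsilon>/2" unfolding ij(3) using p[OF ij(2)] by simp
  qed
  then have "(norm (T (f i) - T (f j)))\<^sup>2 < \<epsilon>\<^sup>2"
    using \<open>0 < \<epsilon>\<close> by (simp add: dist_norm power_strict_mono)
  moreover have "(norm (T (f i) - T (f j)))\<^sup>2 = (s i)\<^sup>2 + (s j)\<^sup>2"
    using norm_add_square[of "T (f i)" "- T (f j)"] ij images[of i j]
      cinner_diff_right[of "T (f i)" 0 "T (f j)"]
    by (simp add: norm_T_basis)
  moreover have "\<epsilon>\<^sup>2 \<le> (s i)\<^sup>2" using ij \<open>0 < \<epsilon>\<close> by (intro power_mono) auto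
  ultimately show False by (smt (verit) zero_le_power2)
qed

lemma norm_T_tail:
  assumes F: "F = {i \<in> I. \<epsilon> \<le> s i}" "finite F" and "0 < \<epsilon>"
  shows "norm (T (x - (\<Sum>i\<in>F. scaleC (cinner x (f i)) (f i)))) \<le> \<epsilon> * norm x"
proof -
  define y where "y = x - (\<Sum>i\<in>F. scaleC (cinner x (f i)) (f i))"
  have "F \<subseteq> I" using F by auto
  then have y: "cinner y (f i) = (if i \<in> F then 0 else cinner x (f i))" if "i \<in> I" for i
    using that F cinner_sum_orthonormal[OF orthonormal_f, of F i "\<lambda>i. cinner x (f i)"]
    by (simp add: y_def cinner_diff_left)
  have "((\<lambda>i. \<epsilon>\<^sup>2 * (cmod (cinner x (f i)))\<^sup>2) has_sum \<epsilon>\<^sup>2 * (norm x)\<^sup>2) I"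
    by (intro has_sum_cmult_right Parseval_norm[OF basis])
  with norm_T_square[of y] have "(norm (T y))\<^sup>2 \<le> \<epsilon>\<^sup>2 * (norm x)\<^sup>2"
  proof (rule has_sum_mono)
    fix i assume i: "i \<in> I"
    show "(s i)\<^sup>2 * (cmod (cinner y (f i)))\<^sup>2 \<le> \<epsilon>\<^sup>2 * (cmod (cinner x (f i)))\<^sup>2"
    proof (cases "i \<in> F")
      case False
      then have "s i \<le> \<epsilon>" using F i by auto
      then show ?thesis using i False s_nonneg[OF i]
        by (auto simp: y intro!: mult_right_mono power_mono)
    qed (simp add: y i)
  qed
  then have "(norm (T y))\<^sup>2 \<le> (\<epsilon> * norm x)\<^sup>2" by (simp add: power_mult_distrib)
  then show ?thesis
    unfolding y_def[symmetric] by (rule power2_le_imp_le) (use \<open>0 < \<epsilon>\<close> in simp)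
qed

text \<open>By \<open>norm_T_tail\<close> the image of the unit ball lies within \<open>\<epsilon>/4\<close> of a compact subset of the span of the
  finitely many \<open>T f\<^sub>i\<close> with \<open>s\<^sub>i \<ge> \<epsilon>/4\<close>; so it is totally bounded.\<close>

lemma finite_imp_compact_op:
  assumes "\<And>\<epsilon>. 0 < \<epsilon> \<Longrightarrow> finite {i \<in> I. \<epsilon> \<le> s i}"
  shows "compact_op T"
proof -
  have "\<exists>K. finite K \<and> closure (T ` cball 0 1) \<subseteq> (\<Union>x\<in>K. ball x \<epsilon>)" if e: "0 < \<epsilon>" for \<epsilon>
  proof -
    define F where "F = {i \<in> I. \<epsilon>/4 \<le> s i}"
    have F: "finite F" "F \<subseteq> I" unfolding F_def using assms[of "\<epsilon>/4"] e by auto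
    let ?C = "{\<Sum>i\<in>F. scaleC (c i) (T (f i)) |c. \<forall>i\<in>F. cmod (c i) \<le> 1}"
    have "compact ?C" by (rule compact_coefficient_box[OF F(1)])
    then obtain K where K: "finite K" "?C \<subseteq> (\<Union>x\<in>K. ball x (\<epsilon>/4))"
      using e unfolding compact_eq_totally_bounded by (meson divide_pos_pos zero_less_numeral)
    have "T x \<in> (\<Union>x\<in>K. cball x (\<epsilon>/2))" if x: "x \<in> cball 0 1" for x
    proof -
      let ?p = "\<Sum>i\<in>F. scaleC (cinner x (f i)) (f i)"
      have "cmod (cinner x (f i)) \<le> 1" if "i \<in> F" for i
        using Cauchy_Schwarz[of x "f i"] x that F orthonormal_norm[OF orthonormal_f, of i] by auto
      then have "T ?p \<in> ?C"
        by (intro CollectI exI[of _ "\<lambda>i. cinner x (f i)"]) (simp add: T_linear)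
      then obtain z where z: "z \<in> K" "dist z (T ?p) < \<epsilon>/4" using K(2) by auto
      have "norm (T (x - ?p)) \<le> \<epsilon>/4 * norm x" by (rule norm_T_tail[OF F_def F(1)]) (use e in simp)
      also have "\<dots> \<le> \<epsilon>/4" using x e by simp
      finally have "dist (T ?p) (T x) \<le> \<epsilon>/4"
        by (simp add: T_linear dist_norm norm_minus_commute)
      then have "dist z (T x) \<le> \<epsilon>/2" using z(2) dist_triangle[of z "T x" "T ?p"] by simp
      then show ?thesis using z(1) by auto
    qed
    then have "closure (T ` cball 0 1) \<subseteq> (\<Union>x\<in>K. cball x (\<epsilon>/2))"
      using K(1) by (intro closure_minimal) auto
    also have "\<dots> \<subseteq> (\<Union>x\<in>K. ball x \<epsilon>)" using e by fastforce
    finally show ?thesis using K(1) by blast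
  qed
  then show ?thesis
    unfolding compact_op_def compact_eq_totally_bounded using T
    by (simp add: complete_eq_closed)
qed

end


section \<open>Sums over eigenvalues counted with multiplicity\<close>

text \<open>The index set of eigenvalues counted with multiplicity is a relabelling of \<open>I\<close>, except that a value
  attained infinitely often has multiplicity \<open>card\<close> = 0 and loses its indices.\<close>

lemma multiplicity_index_bij:
  fixes s :: "'i \<Rightarrow> real"
  obtains \<phi> where
    "bij_betw \<phi> {i \<in> I. finite {j \<in> I. s j = s i}} (SIGMA t:UNIV. {k. k < card {i \<in> I. s i = t}})"
    "\<And>i. fst (\<phi> i) = s i"
proof -
  let ?F = "\<lambda>t. {i \<in> I. s i = t}"
  define h where "h t = (SOME h. bij_betw h (?F t) {..<card (?F t)})" for t
  have h: "bij_betw (h t) (?F t) {..<card (?F t)}" if "finite (?F t)" for t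
    using ex_bij_betw_finite_nat[OF that] unfolding h_def atLeast0LessThan by (rule someI_ex)
  show thesis
  proof (rule that[of "\<lambda>i. (s i, h (s i) i)"])
    show "bij_betw (\<lambda>i. (s i, h (s i) i)) {i \<in> I. finite {j \<in> I. s j = s i}}
        (SIGMA t:UNIV. {k. k < card (?F t)})"
      unfolding bij_betw_def
    proof (intro conjI inj_onI equalityI subsetI)
      fix i j assume i: "i \<in> {i \<in> I. finite (?F (s i))}" and j: "j \<in> {i \<in> I. finite (?F (s i))}"
        and eq: "(s i, h (s i) i) = (s j, h (s j) j)"
      then have "inj_on (h (s i)) (?F (s i))" using h[of "s i"] by (simp add: bij_betw_def)
      then show "i = j" using i j eq by (auto dest: inj_onD)
    next
      fix p assume "p \<in> (\<lambda>i. (s i, h (s i) i)) ` {i \<in> I. finite (?F (s i))}"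
      then obtain i where i: "i \<in> I" "finite (?F (s i))" "p = (s i, h (s i) i)" by auto
      then have "h (s i) i \<in> {..<card (?F (s i))}" using bij_betwE[OF h[OF i(2)]] by auto
      then show "p \<in> (SIGMA t:UNIV. {k. k < card (?F t)})" using i by auto
    next
      fix p assume "p \<in> (SIGMA t:UNIV. {k. k < card (?F t)})"
      then obtain t k where p: "p = (t, k)" "k < card (?F t)" by auto
      have fin: "finite (?F t)" by (rule card_ge_0_finite) (use p(2) in linarith)
      have "k \<in> h t ` ?F t"
        unfolding bij_betw_imp_surj_on[OF h[OF fin]] using p(2) by simp
      then obtain i where i: "i \<in> I" "s i = t" "h t i = k" by blast
      show "p \<in> (\<lambda>i. (s i, h (s i) i)) ` {i \<in> I. finite (?F (s i))}"
        by (rule image_eqI[of _ _ i]) (use i p fin in simp_all)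
    qed
  qed simp
qed

text \<open>The lost indices belong to values on which \<open>g\<close> vanishes. In the application \<open>g t = t\<^sup>r\<close>, and the only
  singular value of a compact operator with infinite multiplicity is 0.\<close>

lemma has_sum_multiplicity_index:
  fixes s :: "'i \<Rightarrow> real"
  assumes "\<And>t. g t \<noteq> (0::real) \<Longrightarrow> finite {i \<in> I. s i = t}"
  shows "((\<lambda>(t, k). g t) has_sum S) (SIGMA t:UNIV. {k. k < card {i \<in> I. s i = t}}) \<longleftrightarrow>
    ((\<lambda>i. g (s i)) has_sum S) I"
proof -
  obtain \<phi> where \<phi>: "bij_betw \<phi> {i \<in> I. finite {j \<in> I. s j = s i}}
      (SIGMA t:UNIV. {k. k < card {i \<in> I. s i = t}})" "\<And>i. fst (\<phi> i) = s i"
    using multiplicity_index_bij[of I s] by blast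
  have "((\<lambda>(t, k). g t) has_sum S) (SIGMA t:UNIV. {k. k < card {i \<in> I. s i = t}}) \<longleftrightarrow>
      ((\<lambda>i. g (s i)) has_sum S) {i \<in> I. finite {j \<in> I. s j = s i}}"
    using has_sum_reindex_bij_betw[OF \<phi>(1), of "\<lambda>(t, k). g t" S]
    by (simp add: case_prod_unfold \<phi>(2))
  also have "\<dots> \<longleftrightarrow> ((\<lambda>i. g (s i)) has_sum S) I"
    by (rule has_sum_cong_neutral) (use assms in auto)
  finally show ?thesis .
qed


section \<open>Schatten classes and traces in a singular basis\<close>

lemma powr_summable_imp_finite:
  fixes s :: "'i \<Rightarrow> real"
  assumes "(\<lambda>i. s i powr r) summable_on I" "0 < r" "0 < \<epsilon>"
  shows "finite {i \<in> I. \<epsilon> \<le> s i}"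
proof (rule ccontr)
  let ?G = "{i \<in> I. \<epsilon> \<le> s i}"
  assume inf: "infinite ?G"
  have "(\<lambda>i. s i powr r) summable_on ?G"
    using assms(1) by (rule summable_on_subset_banach) auto
  then have "(\<lambda>i. \<epsilon> powr r) summable_on ?G"
    by (rule summable_on_comparison_test) (use assms in \<open>auto intro: powr_mono2\<close>)
  then show False
    using inf \<open>0 < \<epsilon>\<close> infsum_diverge_constant[of ?G "\<epsilon> powr r"] by simp
qed

context singular_basis
begin

lemma singular_index_eq: "singular_index T = (SIGMA t:UNIV. {k. k < card {i \<in> I. s i = t}})"
  by (simp add: singular_index_def cdim_eigenspace)

lemma has_sum_singular_index:
  assumes "\<And>\<epsilon>. 0 < \<epsilon> \<Longrightarrow> finite {i \<in> I. \<epsilon> \<le> s i}"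
  shows "((\<lambda>(t, k). t powr r) has_sum S) (singular_index T) \<longleftrightarrow> ((\<lambda>i. s i powr r) has_sum S) I"
  unfolding singular_index_eq
proof (rule has_sum_multiplicity_index)
  fix t assume "t powr r \<noteq> (0::real)"
  then consider "0 < t" | "t < 0" by fastforce
  then show "finite {i \<in> I. s i = t}"
  proof cases
    case 1 then show ?thesis by (intro finite_subset[OF _ assms[OF 1]]) auto
  next
    case 2
    then have "{i \<in> I. s i = t} = {}" using s_nonneg by force
    then show ?thesis by (simp only: finite.emptyI)
  qed
qed

lemma schatten_class_iff:
  assumes "0 < r"
  shows "T \<in> schatten_class r \<longleftrightarrow> (\<lambda>i. s i powr r) summable_on I"
proof
  assume "T \<in> schatten_class r"
  then show "(\<lambda>i. s i powr r) summable_on I"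
    using has_sum_singular_index[OF compact_op_imp_finite]
    by (auto simp: schatten_class_def summable_on_def)
next
  assume *: "(\<lambda>i. s i powr r) summable_on I"
  note fin = powr_summable_imp_finite[OF * assms]
  then show "T \<in> schatten_class r"
    using has_sum_singular_index[OF fin] finite_imp_compact_op[OF fin] *
    by (auto simp: schatten_class_def summable_on_def)
qed

lemma schatten_norm_eq:
  assumes "T \<in> schatten_class r" "0 < r"
  shows "schatten_norm r T = (\<Sum>\<^sub>\<infinity>i\<in>I. s i powr r) powr (1 / r)"
proof -
  have sum: "(\<lambda>i. s i powr r) summable_on I" using assms by (simp add: schatten_class_iff)
  note fin = powr_summable_imp_finite[OF sum assms(2)]
  have "((\<lambda>(t, k). t powr r) has_sum (\<Sum>\<^sub>\<infinity>i\<in>I. s i powr r)) (singular_index T)"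
    using has_sum_singular_index[OF fin] has_sum_infsum[OF sum] by blast
  then show ?thesis by (simp add: schatten_norm_def infsumI)
qed

text \<open>Both \<open>\<Sum>\<^sub>i (T f\<^sub>i, f\<^sub>i)\<close> and \<open>\<Sum>\<^sub>j (T g\<^sub>j, g\<^sub>j)\<close> arise by Parseval from the double family
  \<open>(T f\<^sub>i, g\<^sub>j) (g\<^sub>j, f\<^sub>i)\<close>, whose absolute sum over \<open>j\<close> is at most \<open>\<parallel>T f\<^sub>i\<parallel> = s\<^sub>i\<close>.\<close>

lemma diagonal_sum_basis_independent:
  fixes g :: "'j \<Rightarrow> 'a"
  assumes sum: "s summable_on I" and g: "orthonormal_basis J g"
  shows "((\<lambda>j. cinner (T (g j)) (g j)) has_sum (\<Sum>\<^sub>\<infinity>i\<in>I. cinner (T (f i)) (f i))) J"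
proof -
  define h where "h = (\<lambda>(i, j). cinner (T (f i)) (g j) * cinner (g j) (f i))"
  note CS = Bessel_Cauchy_Schwarz[OF orthonormal_basis_orthonormal[OF g]]
  have "h abs_summable_on I \<times> J"
    unfolding abs_summable_on_Sigma_iff
  proof (intro conjI ballI)
    show "(\<lambda>j. h (i, j)) abs_summable_on J" for i
      using CS(1)[of "T (f i)" "f i"] by (simp add: h_def norm_mult)
    show "(\<lambda>i. \<Sum>\<^sub>\<infinity>j\<in>J. norm (h (i, j))) abs_summable_on I"
    proof (rule abs_summable_on_comparison_test'[OF sum])
      fix i assume i: "i \<in> I"
      have "0 \<le> (\<Sum>\<^sub>\<infinity>j\<in>J. norm (h (i, j)))" by (rule infsum_nonneg) simp
      then show "norm (\<Sum>\<^sub>\<infinity>j\<in>J. norm (h (i, j))) \<le> s i"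
        using CS(2)[of "T (f i)" "f i"] i
        by (simp add: h_def norm_mult norm_T_basis orthonormal_norm[OF orthonormal_f])
    qed
  qed
  then have "h summable_on I \<times> J" by (rule abs_summable_summable)
  then obtain S where S: "(h has_sum S) (I \<times> J)" by (auto simp: summable_on_def)
  have "((\<lambda>j. h (i, j)) has_sum cinner (T (f i)) (f i)) J" for i
    using Parseval[OF g, of "T (f i)" "f i"] by (simp add: h_def)
  with S have "((\<lambda>i. cinner (T (f i)) (f i)) has_sum S) I" by (rule has_sum_SigmaD)
  then have "(\<Sum>\<^sub>\<infinity>i\<in>I. cinner (T (f i)) (f i)) = S" by (rule infsumI)
  moreover have "((\<lambda>i. h (i, j)) has_sum cinner (T (g j)) (g j)) I" for j
    using has_sum_bounded_linear[OF bounded_linear_compose[OF bounded_linear_cinner_left T_linear(1)]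
        orthonormal_basis_expansion[OF basis], of "g j" "g j"]
    by (simp add: h_def T_linear cinner_scaleC_left mult.commute)
  then have "((\<lambda>j. cinner (T (g j)) (g j)) has_sum S) J"
    using S[unfolded has_sum_swap[of h]] by (intro has_sum_SigmaD[where f = "\<lambda>(j, i). h (i, j)"]) auto
  ultimately show ?thesis by simp
qed

lemma orthonormal_basis_image: "orthonormal_basis (f ` I) (\<lambda>b. b)"
  using basis orthonormal_inj_on[OF orthonormal_f] by (auto simp: orthonormal_basis_def inj_on_eq_iff)

lemma trace_op_has_sum:
  fixes g :: "'j \<Rightarrow> 'a"
  assumes sum: "s summable_on I" and g: "orthonormal_basis J g"
  shows "((\<lambda>j. cinner (T (g j)) (g j)) has_sum trace_op T) J"
proof -
  have "trace_op T = (\<Sum>\<^sub>\<infinity>i\<in>I. cinner (T (f i)) (f i))"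
    unfolding trace_op_def
  proof (rule the_equality)
    fix t assume "\<forall>B. orthonormal_basis B (\<lambda>b. b) \<longrightarrow> ((\<lambda>b. cinner (T b) b) has_sum t) B"
    with orthonormal_basis_image have "((\<lambda>b. cinner (T b) b) has_sum t) (f ` I)" by blast
    with diagonal_sum_basis_independent[OF sum orthonormal_basis_image]
    show "t = (\<Sum>\<^sub>\<infinity>i\<in>I. cinner (T (f i)) (f i))" by (rule has_sum_unique[symmetric])
  qed (use diagonal_sum_basis_independent[OF sum] in blast)
  then show ?thesis using diagonal_sum_basis_independent[OF sum g] by simp
qed

end


section \<open>Singular values of matrices\<close>

unbundle no vec_syntax

abbreviation diag_real :: "nat \<Rightarrow> (nat \<Rightarrow> real) \<Rightarrow> complex mat" where
  "diag_real n s \<equiv> Matrix.mat n n (\<lambda>(i, j). if i = j then complex_of_real (s i) else 0)"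

lemma mat_adjoint_carrier [simp]:
  "A \<in> carrier_mat m n \<Longrightarrow> mat_adjoint (A :: complex mat) \<in> carrier_mat n m"
  by (auto simp: mat_adjoint_def mat_of_rows_def)

lemma mat_adjoint_dim [simp]:
  "dim_row (mat_adjoint (A :: complex mat)) = dim_col A" "dim_col (mat_adjoint A) = dim_row A"
  by (auto simp: mat_adjoint_def)

lemma mat_adjoint_index [simp]:
  "i < dim_col A \<Longrightarrow> j < dim_row A \<Longrightarrow> mat_adjoint (A :: complex mat) $$ (i, j) = cnj (A $$ (j, i))"
  by (simp add: mat_adjoint_def mat_of_rows_index)

lemma mat_adjoint_mult:
  assumes "A \<in> carrier_mat m n" "B \<in> carrier_mat n p"
  shows "mat_adjoint (A * B :: complex mat) = mat_adjoint B * mat_adjoint A"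
  by (rule eq_matI) (use assms in \<open>auto simp: scalar_prod_def mult.commute\<close>)

lemma adjoint_scalar_prod:
  assumes "A \<in> carrier_mat m n" "x \<in> carrier_vec n" "y \<in> carrier_vec m"
  shows "(A *\<^sub>v x) \<bullet>c y = x \<bullet>c (mat_adjoint (A :: complex mat) *\<^sub>v y)"
proof -
  have "(A *\<^sub>v x) \<bullet>c y = (\<Sum>i<m. \<Sum>j<n. A $$ (i, j) * x $ j * cnj (y $ i))"
    using assms by (simp add: scalar_prod_def sum_distrib_right atLeast0LessThan)
  also have "\<dots> = (\<Sum>j<n. \<Sum>i<m. A $$ (i, j) * x $ j * cnj (y $ i))" by (rule sum.swap)
  also have "\<dots> = x \<bullet>c (mat_adjoint A *\<^sub>v y)"
    using assms by (simp add: scalar_prod_def sum_distrib_left atLeast0LessThan mult_ac)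
  finally show ?thesis .
qed

lemma diag_real_mult: "diag_real n s * diag_real n t = diag_real n (\<lambda>i. s i * t i)"
  by (rule eq_matI) (auto simp: scalar_prod_def if_distrib sum.delta cong: if_cong)

lemma cscalar_prod_self_real:
  assumes "x \<in> carrier_vec n"
  shows "x \<bullet>c x = complex_of_real (Re (x \<bullet>c x))" "0 \<le> Re (x \<bullet>c x)"
proof -
  have "x \<bullet>c x = complex_of_real (\<Sum>i<n. (cmod (x $ i))\<^sup>2)"
    using assms by (simp add: scalar_prod_def atLeast0LessThan complex_norm_square del: of_real_power)
  then show "x \<bullet>c x = complex_of_real (Re (x \<bullet>c x))" "0 \<le> Re (x \<bullet>c x)"
    by (simp_all add: sum_nonneg)
qed

text \<open>The argument of \<open>positive_sqrt_eigenvector\<close>, for matrices.\<close>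

lemma positive_mat_sqrt_eigenvector:
  assumes C: "positive_mat C" "C \<in> carrier_mat n n" and x: "x \<in> carrier_vec n"
    and sq: "C *\<^sub>v (C *\<^sub>v x) = complex_of_real (t\<^sup>2) \<cdot>\<^sub>v x" and t: "0 \<le> t"
  shows "C *\<^sub>v x = complex_of_real t \<cdot>\<^sub>v x"
proof -
  have pos: "0 \<le> (C *\<^sub>v y) \<bullet>c y" if "y \<in> carrier_vec n" for y
    using C that by (auto simp: positive_mat_def)
  define h where "h = C *\<^sub>v x - complex_of_real t \<cdot>\<^sub>v x"
  have Cx: "C *\<^sub>v x \<in> carrier_vec n" using C x by simp
  have h: "h \<in> carrier_vec n" using Cx x by (simp add: h_def)
  have Ch: "C *\<^sub>v h = - complex_of_real t \<cdot>\<^sub>v h"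
  proof -
    have "C *\<^sub>v h = C *\<^sub>v (C *\<^sub>v x) - complex_of_real t \<cdot>\<^sub>v (C *\<^sub>v x)"
      unfolding h_def using C x Cx by (simp add: mult_minus_distrib_mat_vec mult_mat_vec)
    then show ?thesis
      unfolding sq using Cx x C by (auto simp: h_def algebra_simps power2_eq_square)
  qed
  note hh = cscalar_prod_self_real[OF h]
  have "h \<bullet>c h = 0"
  proof (cases "t = 0")
    case False
    have "0 \<le> (C *\<^sub>v h) \<bullet>c h" by (rule pos[OF h])
    then have "0 \<le> - complex_of_real t * (h \<bullet>c h)"
      unfolding Ch using h by (simp add: smult_scalar_prod_distrib[of _ n])
    then have "t * Re (h \<bullet>c h) \<le> 0" by (simp add: less_eq_complex_def)
    then have "Re (h \<bullet>c h) = 0" using False t hh(2) by (simp add: mult_le_0_iff)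
    then show ?thesis using hh(1) by simp
  next
    case True
    then have Ch0: "C *\<^sub>v h = 0\<^sub>v n" using Ch h by auto
    have Cx_h: "C *\<^sub>v x = h" using C x by (intro eq_vecI) (auto simp: h_def True)
    show ?thesis
    proof (rule ccontr)
      assume "h \<bullet>c h \<noteq> 0"
      then have h0: "Re (h \<bullet>c h) \<noteq> 0" using hh(1) by auto
      define a where "a = (Re (h \<bullet>c x) + 1) / Re (h \<bullet>c h)"
      define y where "y = x - complex_of_real a \<cdot>\<^sub>v h"
      have y: "y \<in> carrier_vec n" using x h by (simp add: y_def)
      have "C *\<^sub>v y = h"
      proof -
        have "C *\<^sub>v y = h - complex_of_real a \<cdot>\<^sub>v 0\<^sub>v n"
          unfolding y_def using C x h
          by (simp add: mult_minus_distrib_mat_vec mult_mat_vec Ch0 Cx_h)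
        also have "\<dots> = h" using h by (intro eq_vecI) auto
        finally show ?thesis .
      qed
      moreover have "h \<bullet>c y = h \<bullet>c x - complex_of_real a * (h \<bullet>c h)"
        using x h by (simp add: y_def scalar_prod_def sum_subtractf sum_distrib_left algebra_simps)
      ultimately have "0 \<le> h \<bullet>c x - complex_of_real a * (h \<bullet>c h)" using pos[OF y] by simp
      then show False using h0 by (simp add: a_def less_eq_complex_def)
    qed
  qed
  then have "h = 0\<^sub>v n" using h conjugate_square_eq_0_vec[OF h] by simp
  show ?thesis
  proof (rule eq_vecI)
    fix i assume "i < dim_vec (complex_of_real t \<cdot>\<^sub>v x)"
    then have i: "i < n" using x by simp
    then have "h $ i = 0" using \<open>h = 0\<^sub>v n\<close> by simp
    then show "(C *\<^sub>v x) $ i = (complex_of_real t \<cdot>\<^sub>v x) $ i"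
      using Cx x i C(2) by (simp add: h_def)
  qed (use C x in auto)
qed

text \<open>The matrix counterpart of \<open>singular_basis\<close>: the columns of \<open>U\<close> are the orthonormal basis, and the
  last assumption says that their images under \<open>S\<close> are orthogonal with lengths \<open>s\<^sub>i\<close>.\<close>

locale singular_mat =
  fixes n :: nat and S U :: "complex mat" and s :: "nat \<Rightarrow> real"
  assumes S: "S \<in> carrier_mat n n" and U: "U \<in> carrier_mat n n"
    and unitary: "mat_adjoint U * U = 1\<^sub>m n"
    and s_nonneg: "\<And>i. i < n \<Longrightarrow> 0 \<le> s i"
    and images: "mat_adjoint (S * U) * (S * U) = diag_real n (\<lambda>i. (s i)\<^sup>2)"
begin

abbreviation "U' \<equiv> mat_adjoint U"
abbreviation "D \<equiv> diag_real n s"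

lemma U': "U' \<in> carrier_mat n n" using U by simp
lemma D: "D \<in> carrier_mat n n" by simp

lemmas square_mat_simps = assoc_mult_mat[of _ n n _ n _ n] mult_carrier_mat[of _ n n _ n]
  assoc_mult_mat_vec[of _ n n _ n] mult_mat_vec_carrier[of _ n n] U U' S D

lemma unitary': "U * U' = 1\<^sub>m n"
  by (rule mat_mult_left_right_inverse[OF U' U unitary])

lemma gram_eq: "mat_adjoint S * S = U * (D * D) * U'"
proof -
  have S': "mat_adjoint S \<in> carrier_mat n n" using S by simp
  have DD: "D * D = diag_real n (\<lambda>i. (s i)\<^sup>2)" by (simp only: diag_real_mult power2_eq_square)
  have "D * D = U' * mat_adjoint S * (S * U)"
    unfolding DD images[symmetric] by (simp only: mat_adjoint_mult[OF S U])
  then have "U * (D * D) * U' = U * (U' * mat_adjoint S * (S * U)) * U'" by simp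
  also have "\<dots> = (U * U') * (mat_adjoint S * S) * (U * U')"
    using S' by (simp add: square_mat_simps)
  also have "\<dots> = mat_adjoint S * S" unfolding unitary' using S S' by simp
  finally show ?thesis by simp
qed

lemma abs_candidate_positive: "positive_mat (U * D * U')"
proof -
  have "0 \<le> (U * D * U' *\<^sub>v v) \<bullet>c v" if v: "v \<in> carrier_vec n" for v
  proof -
    define w where "w = U' *\<^sub>v v"
    have w: "w \<in> carrier_vec n" using U' v by (simp add: w_def)
    have "U * D * U' *\<^sub>v v = U *\<^sub>v (D *\<^sub>v w)"
      using v by (simp add: w_def square_mat_simps)
    then have "(U * D * U' *\<^sub>v v) \<bullet>c v = (D *\<^sub>v w) \<bullet>c w"
      using adjoint_scalar_prod[OF U mult_mat_vec_carrier[OF D w] v] by (simp add: w_def)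
    also have "\<dots> = (\<Sum>i<n. complex_of_real (s i * (cmod (w $ i))\<^sup>2))"
      using w by (simp add: scalar_prod_def atLeast0LessThan if_distrib[of "\<lambda>x. x * _"] sum.delta
          complex_norm_square mult.assoc cong: if_cong del: of_real_power)
    also have "\<dots> = complex_of_real (\<Sum>i<n. s i * (cmod (w $ i))\<^sup>2)" by simp
    finally show ?thesis using s_nonneg by (auto simp: less_eq_complex_def intro!: sum_nonneg)
  qed
  then show ?thesis using U U' by (auto simp: positive_mat_def)
qed

lemma abs_candidate_square: "(U * D * U') * (U * D * U') = mat_adjoint S * S"
proof -
  have "(U * D * U') * (U * D * U') = U * D * (U' * U) * D * U'"
    by (simp add: square_mat_simps)
  also have "\<dots> = U * (D * D) * U'"
    unfolding unitary by (simp add: square_mat_simps)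
  finally show ?thesis by (simp only: gram_eq)
qed

lemma abs_mat_eq: "abs_mat S = U * D * U'"
  unfolding abs_mat_def
proof (rule the_equality)
  fix C assume C: "positive_mat C \<and> C * C = mat_adjoint S * S"
  have "dim_row C = dim_row (C * C)" by simp
  also have "\<dots> = n" using C S by simp
  finally have Cn: "C \<in> carrier_mat n n" using C by (auto simp: positive_mat_def)
  have "C * U = U * D"
  proof (rule mat_col_eqI)
    fix k assume "k < dim_col (U * D)"
    then have k: "k < n" by simp
    have x: "col U k \<in> carrier_vec n" using U k by simp
    have UD: "col (U * diag_real n t) k = complex_of_real (t k) \<cdot>\<^sub>v col U k" for t
      using U k by (auto simp: scalar_prod_def if_distrib sum.delta mult.commute cong: if_cong)
    have "C *\<^sub>v (C *\<^sub>v col U k) = (C * C) *\<^sub>v col U k"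
      using Cn x by (simp add: assoc_mult_mat_vec)
    also have "\<dots> = col (C * C * U) k"
      by (rule col_mult2[symmetric, OF mult_carrier_mat[OF Cn Cn] U k])
    also have "C * C * U = U * (D * D) * (U' * U)"
      using C by (simp add: gram_eq square_mat_simps)
    also have "\<dots> = U * diag_real n (\<lambda>i. s i * s i)"
      unfolding unitary diag_real_mult using U by simp
    also have "col \<dots> k = complex_of_real ((s k)\<^sup>2) \<cdot>\<^sub>v col U k"
      unfolding UD by (simp add: power2_eq_square)
    finally have "C *\<^sub>v col U k = complex_of_real (s k) \<cdot>\<^sub>v col U k"
      using C by (intro positive_mat_sqrt_eigenvector[OF _ Cn x _ s_nonneg[OF k]]) auto
    then show "col (C * U) k = col (U * D) k" unfolding UD col_mult2[OF Cn U k] .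
  qed (use Cn U in auto)
  then have "C * (U * U') = U * D * U'"
    using Cn U' assoc_mult_mat[OF Cn U U'] by simp
  then show "C = U * D * U'" unfolding unitary' using Cn by simp
qed (use abs_candidate_positive abs_candidate_square in blast)

lemma order_char_poly_abs:
  "Polynomial.order (complex_of_real t) (char_poly (abs_mat S)) = card {i \<in> {..<n}. s i = t}"
proof -
  have "similar_mat (abs_mat S) D"
    by (rule similar_matI[of _ _ U U' n])
       (use U U' D unitary unitary' abs_mat_eq in auto)
  then have "char_poly (abs_mat S) = char_poly D" by (rule char_poly_similar)
  also have "\<dots> = (\<Prod>a\<leftarrow>diag_mat D. [:- a, 1:])"
    by (rule char_poly_upper_triangular[OF D]) auto
  also have "diag_mat D = map (\<lambda>i. complex_of_real (s i)) [0..<n]"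
    by (auto simp: diag_mat_def)
  finally have "Polynomial.order (complex_of_real t) (char_poly (abs_mat S)) =
      Polynomial.order (complex_of_real t) (\<Prod>i\<leftarrow>[0..<n]. [:- complex_of_real (s i), 1:])"
    by (simp add: comp_def)
  also have "\<dots> = (\<Sum>i\<leftarrow>[0..<n]. Polynomial.order (complex_of_real t) [:- complex_of_real (s i), 1:])"
    by (subst order_prod_list) (auto simp: comp_def)
  also have "\<dots> = (\<Sum>i<n. if s i = t then 1 else 0)"
    by (simp add: order_linear' interv_sum_list_conv_sum_set_nat atLeast0LessThan if_distrib cong: if_cong)
  also have "\<dots> = card {i \<in> {..<n}. s i = t}"
    by (simp add: sum.If_cases Int_def conj_commute)
  finally show ?thesis .
qed

lemma schatten_norm_mat_powr:
  assumes "0 < r"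
  shows "schatten_norm_mat r S powr r = (\<Sum>i<n. s i powr r)"
proof -
  have idx: "singular_index_mat S = (SIGMA t:UNIV. {k. k < card {i \<in> {..<n}. s i = t}})"
    by (simp add: singular_index_mat_def order_char_poly_abs)
  obtain \<phi> where \<phi>: "bij_betw \<phi> {i \<in> {..<n}. finite {j \<in> {..<n}. s j = s i}} (singular_index_mat S)"
    "\<And>i. fst (\<phi> i) = s i"
    using multiplicity_index_bij[of "{..<n}" s] unfolding idx by blast
  have "{i \<in> {..<n}. finite {j \<in> {..<n}. s j = s i}} = {..<n}" by auto
  with sum.reindex_bij_betw[OF \<phi>(1), of "\<lambda>(t, k). t powr r"]
  have "(\<Sum>(t, k)\<in>singular_index_mat S. t powr r) = (\<Sum>i<n. s i powr r)"
    by (simp add: case_prod_unfold \<phi>(2))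
  then show ?thesis
    using assms by (simp add: schatten_norm_mat_def powr_powr sum_nonneg)
qed

end


section \<open>Block decompositions\<close>

locale invariant_operator =
  fixes d :: "nat \<Rightarrow> nat" and e :: "nat \<Rightarrow> nat \<Rightarrow> 'a::complex_hilbert_space" and T :: "'a \<Rightarrow> 'a"
  assumes basis_e: "orthonormal_basis (basis_index d) (\<lambda>(j, k). e j k)"
    and T: "bounded_clinear T"
    and invariant: "invariant_op (block d e) T"
begin

lemma orthonormal_e: "orthonormal {1..d l} (e l)"
  using orthonormal_basis_orthonormal[OF basis_e]
  by (fastforce simp: orthonormal_def basis_index_def)

lemma T_block: "x \<in> block d e l \<Longrightarrow> T x \<in> block d e l"
  using invariant by (auto simp: invariant_op_def)

lemma block_expansion:
  assumes "x \<in> block d e l"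
  shows "x = (\<Sum>a<d l. scaleC (cinner x (e l (Suc a))) (e l (Suc a)))"
  using cspan_orthonormal_expansion[OF orthonormal_e[of l], of x] assms
  by (simp add: block_def sum.atLeast1_atMost_eq)

lemma block_Parseval:
  assumes "x \<in> block d e l"
  shows "cinner x y = (\<Sum>a<d l. cinner x (e l (Suc a)) * cnj (cinner y (e l (Suc a))))"
proof -
  have "cinner x y = cinner (\<Sum>a<d l. scaleC (cinner x (e l (Suc a))) (e l (Suc a))) y"
    by (rule arg_cong[OF block_expansion[OF assms]])
  then show ?thesis
    by (simp add: cinner_sum_left cinner_scaleC_left cinner_commute[of "e l (Suc _)" y])
qed

lemma block_orthogonal:
  assumes "x \<in> block d e l" "y \<in> block d e l'" "l \<noteq> l'"
  shows "cinner x y = 0"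
proof -
  have ee: "cinner (e l (Suc a)) (e l' (Suc b)) = 0" if "a < d l" "b < d l'" for a b
    using orthonormalD[OF orthonormal_basis_orthonormal[OF basis_e], of "(l, Suc a)" "(l', Suc b)"]
      that assms(3) by (simp add: basis_index_def)
  have "cinner x y = cinner (\<Sum>a<d l. scaleC (cinner x (e l (Suc a))) (e l (Suc a)))
      (\<Sum>b<d l'. scaleC (cinner y (e l' (Suc b))) (e l' (Suc b)))"
    by (rule arg_cong2[OF block_expansion[OF assms(1)] block_expansion[OF assms(2)]])
  then show ?thesis
    by (simp add: cinner_sum_left cinner_sum_right cinner_scaleC_left cinner_scaleC_right ee)
qed

text \<open>A further vector outside the span would give \<open>d\<^sub>l + 1\<close> independent vectors in the span of \<open>d\<^sub>l\<close>.\<close>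

lemma block_spanned:
  assumes f: "orthonormal {..<d l} f" "f ` {..<d l} \<subseteq> block d e l"
  shows "block d e l \<subseteq> cspan (f ` {..<d l})"
proof (rule ccontr)
  assume "\<not> ?thesis"
  then obtain v where v: "v \<in> block d e l" "v \<notin> cspan (f ` {..<d l})" by blast
  have "complex_vector.independent (insert v (f ` {..<d l}))"
    by (rule complex_vector.independent_insertI[OF v(2) orthonormal_independent[OF f(1)]])
  moreover have "insert v (f ` {..<d l}) \<subseteq> cspan (e l ` {1..d l})"
    using f(2) v(1) by (simp add: block_def)
  ultimately have "card (insert v (f ` {..<d l})) \<le> card (e l ` {1..d l})"
    using complex_vector.independent_span_bound[of "e l ` {1..d l}"] by simp
  also have "\<dots> \<le> d l" using card_image_le[of "{1..d l}" "e l"] by simp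
  also have "card (insert v (f ` {..<d l})) = Suc (d l)"
    using v(2) complex_vector.span_base[of v "f ` {..<d l}"] orthonormal_inj_on[OF f(1)]
    by (subst card_insert_disjoint) (auto simp: card_image)
  finally show False by simp
qed

lemma symbol_mult_coordinates:
  assumes f: "f ` {..<d l} \<subseteq> block d e l"
  shows "symbol d e T l * Matrix.mat (d l) (d l) (\<lambda>(a, k). cinner (f k) (e l (Suc a))) =
    Matrix.mat (d l) (d l) (\<lambda>(m, k). cinner (T (f k)) (e l (Suc m)))" (is "_ * ?U = ?R")
proof (rule eq_matI)
  fix m k assume "m < dim_row ?R" "k < dim_col ?R"
  then have mk: "m < d l" "k < d l" by auto
  have "T (f k) = T (\<Sum>a<d l. scaleC (cinner (f k) (e l (Suc a))) (e l (Suc a)))"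
    using f mk(2) by (intro arg_cong[OF block_expansion]) auto
  then have "cinner (T (f k)) (e l (Suc m)) =
      (\<Sum>a<d l. cinner (T (e l (Suc a))) (e l (Suc m)) * cinner (f k) (e l (Suc a)))"
    by (simp add: bounded_clinearD[OF T] cinner_sum_left cinner_scaleC_left mult.commute)
  then show "(symbol d e T l * ?U) $$ (m, k) = ?R $$ (m, k)"
    using mk by (simp add: symbol_def scalar_prod_def atLeast0LessThan)
qed (auto simp: symbol_def)

text \<open>Used twice: with \<open>x = f\<^sub>l\<close>, where it says that \<open>U\<close> is unitary, and with \<open>x = T \<circ> f\<^sub>l\<close>, where by the
  preceding lemma the coordinate matrix is \<open>\<sigma>(l) U\<close>.\<close>

lemma coordinate_Gram_matrix:
  assumes x: "\<And>k. k < d l \<Longrightarrow> x k \<in> block d e l"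
    and orth: "\<And>i j. i < d l \<Longrightarrow> j < d l \<Longrightarrow>
      cinner (x i) (x j) = (if i = j then complex_of_real (t i) else 0)"
  defines "X \<equiv> Matrix.mat (d l) (d l) (\<lambda>(a, k). cinner (x k) (e l (Suc a)))"
  shows "mat_adjoint X * X = diag_real (d l) t"
proof (rule eq_matI)
  fix i j assume "i < dim_row (diag_real (d l) t)" "j < dim_col (diag_real (d l) t)"
  then have ij: "i < d l" "j < d l" by auto
  have "(mat_adjoint X * X) $$ (i, j) =
      (\<Sum>a<d l. cinner (x j) (e l (Suc a)) * cnj (cinner (x i) (e l (Suc a))))"
    using ij by (simp add: X_def scalar_prod_def atLeast0LessThan mult.commute)
  also have "\<dots> = cinner (x j) (x i)" by (rule block_Parseval[OF x[OF ij(2)], symmetric])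
  finally show "(mat_adjoint X * X) $$ (i, j) = diag_real (d l) t $$ (i, j)"
    using ij by (simp add: orth)
qed (auto simp: X_def)

text \<open>One family of vectors plays both roles: it is a singular basis for \<open>T\<close>, and block by block its
  coordinates form the unitary matrix that diagonalizes \<open>|\<sigma>(l)|\<close>. The operator and its symbol
  therefore share the same numbers \<open>s l k\<close>.\<close>

lemma singular_bases_exist:
  obtains f s where
    "singular_basis (SIGMA l:UNIV. {..<d l}) (\<lambda>(l, k). f l k) T (\<lambda>(l, k). s l k)"
    "\<And>l. singular_mat (d l) (symbol d e T l)
       (Matrix.mat (d l) (d l) (\<lambda>(a, k). cinner (f l k) (e l (Suc a)))) (s l)"
proof -
  let ?P = "\<lambda>l f. orthonormal {..<d l} f \<and> f ` {..<d l} \<subseteq> block d e l \<and>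
    (\<forall>i<d l. \<forall>j<d l. cinner (T (f i)) (T (f j)) =
      (if i = j then complex_of_real ((norm (T (f i)))\<^sup>2) else 0))"
  have "\<exists>f :: nat \<Rightarrow> 'a. ?P l f" for l
    by (rule SVD_finite_dimensional[OF orthonormal_e[of l] _ T]) (auto simp: block_def)
  then have "\<forall>l. \<exists>f :: nat \<Rightarrow> 'a. ?P l f" by blast
  from choice[OF this] obtain f where f: "\<And>l. ?P l (f l)" by blast
  define s where "s l k = norm (T (f l k))" for l k
  let ?I = "SIGMA l:UNIV. {..<d l}" and ?f = "\<lambda>(l, k). f l k"
  have on: "orthonormal {..<d l} (f l)" and mem: "k < d l \<Longrightarrow> f l k \<in> block d e l"
    and orth: "i < d l \<Longrightarrow> j < d l \<Longrightarrow>
      cinner (T (f l i)) (T (f l j)) = (if i = j then complex_of_real ((s l i)\<^sup>2) else 0)" for l i j k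
    using f[of l] unfolding s_def by blast+
  have basis: "orthonormal_basis ?I ?f"
    unfolding orthonormal_basis_def
  proof (intro conjI ballI)
    fix p q assume p: "p \<in> ?I" and q: "q \<in> ?I"
    show "cinner (?f p) (?f q) = (if p = q then 1 else 0)"
    proof (cases "fst p = fst q")
      case True
      then show ?thesis
        using p q orthonormalD[OF on[of "fst p"], of "snd p" "snd q"] by (auto simp: prod_eq_iff)
    next
      case False
      then show ?thesis
        using p q block_orthogonal[of "?f p" "fst p" "?f q" "fst q"] mem by auto
    qed
  next
    have "e l k \<in> cspan (?f ` ?I)" if "k \<in> {1..d l}" for l k
    proof -
      have "e l k \<in> block d e l"
        unfolding block_def using that by (intro complex_vector.span_base) simp
      also have "\<dots> \<subseteq> cspan (f l ` {..<d l})"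
        by (rule block_spanned[OF on]) (auto intro: mem)
      also have "\<dots> \<subseteq> cspan (?f ` ?I)"
        by (intro complex_vector.span_mono) force
      finally show ?thesis .
    qed
    then have "cspan ((\<lambda>(j, k). e j k) ` basis_index d) \<subseteq> cspan (?f ` ?I)"
      by (intro complex_vector.span_minimal complex_vector.subspace_span)
         (auto simp: basis_index_def)
    then have "closure (cspan ((\<lambda>(j, k). e j k) ` basis_index d)) \<subseteq> closure (cspan (?f ` ?I))"
      by (rule closure_mono)
    then show "closure (cspan (?f ` ?I)) = UNIV" using basis_e by (auto simp: orthonormal_basis_def)
  qed
  show thesis
  proof (rule that[of f s])
    show "singular_basis ?I ?f T (\<lambda>(l, k). s l k)"
    proof
      fix p q assume p: "p \<in> ?I" and q: "q \<in> ?I"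
      show "cinner (T (?f p)) (T (?f q)) =
          (if p = q then complex_of_real ((case p of (l, k) \<Rightarrow> s l k)\<^sup>2) else 0)"
      proof (cases "fst p = fst q")
        case True
        then show ?thesis
          using p q orth[of "snd p" "fst p" "snd q"] by (auto simp: prod_eq_iff split_beta)
      next
        case False
        then have "cinner (T (?f p)) (T (?f q)) = 0"
          using p q mem by (intro block_orthogonal[OF T_block T_block]) auto
        with False show ?thesis by auto
      qed
    qed (use basis T in \<open>auto simp: s_def\<close>)
    fix l
    show "singular_mat (d l) (symbol d e T l)
       (Matrix.mat (d l) (d l) (\<lambda>(a, k). cinner (f l k) (e l (Suc a)))) (s l)" (is "singular_mat _ _ ?U _")
    proof
      show "mat_adjoint ?U * ?U = 1\<^sub>m (d l)"
      proof -
        have "mat_adjoint ?U * ?U = diag_real (d l) (\<lambda>_. 1)"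
          by (rule coordinate_Gram_matrix) (use mem orthonormalD[OF on[of l]] in auto)
        also have "\<dots> = 1\<^sub>m (d l)" by (rule eq_matI) auto
        finally show ?thesis .
      qed
      show "mat_adjoint (symbol d e T l * ?U) * (symbol d e T l * ?U) = diag_real (d l) (\<lambda>i. (s l i)\<^sup>2)"
      proof -
        have "f l ` {..<d l} \<subseteq> block d e l" using mem by auto
        from symbol_mult_coordinates[OF this] show ?thesis
          using coordinate_Gram_matrix[of l "\<lambda>k. T (f l k)" "\<lambda>i. (s l i)\<^sup>2"] T_block mem orth by simp
      qed
    qed (auto simp: symbol_def s_def)
  qed
qed

end

lemma summable_on_Sigma_lessThan_iff:
  fixes g :: "nat \<Rightarrow> nat \<Rightarrow> real"
  assumes "\<And>l k. 0 \<le> g l k"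
  shows "(\<lambda>(l, k). g l k) summable_on (SIGMA l:UNIV. {..<d l}) \<longleftrightarrow> summable (\<lambda>l. \<Sum>k<d l. g l k)"
proof -
  have "(\<lambda>(l, k). g l k) summable_on (SIGMA l:UNIV. {..<d l}) \<longleftrightarrow> (\<lambda>l. \<Sum>k<d l. g l k) summable_on UNIV"
  proof
    assume "(\<lambda>(l, k). g l k) summable_on (SIGMA l:UNIV. {..<d l})"
    from summable_on_SigmaD[OF this] show "(\<lambda>l. \<Sum>k<d l. g l k) summable_on UNIV" by simp
  next
    assume "(\<lambda>l. \<Sum>k<d l. g l k) summable_on UNIV"
    then show "(\<lambda>(l, k). g l k) summable_on (SIGMA l:UNIV. {..<d l})"
      by (rule summable_on_SigmaI[rotated]) (use assms in auto)
  qed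
  also have "\<dots> \<longleftrightarrow> summable (\<lambda>l. \<Sum>k<d l. g l k)"
    by (rule summable_on_UNIV_nonneg_real_iff) (simp add: assms sum_nonneg)
  finally show ?thesis .
qed

lemma infsum_Sigma_lessThan:
  fixes g :: "nat \<Rightarrow> nat \<Rightarrow> real"
  assumes "(\<lambda>(l, k). g l k) summable_on (SIGMA l:UNIV. {..<d l})"
  shows "(\<Sum>\<^sub>\<infinity>(l, k)\<in>(SIGMA l:UNIV. {..<d l}). g l k) = (\<Sum>l. \<Sum>k<d l. g l k)"
proof -
  have "((\<lambda>l. \<Sum>k<d l. g l k) has_sum (\<Sum>\<^sub>\<infinity>(l, k)\<in>(SIGMA l:UNIV. {..<d l}). g l k)) UNIV"
    using has_sum_infsum[OF assms] by (rule has_sum_SigmaD) auto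
  then show ?thesis by (intro sums_unique has_sum_imp_sums)
qed

theorem theorem2p5:
  fixes d :: "nat \<Rightarrow> nat"
    and e :: "nat \<Rightarrow> nat \<Rightarrow> 'a::complex_hilbert_space"
    and T :: "'a \<Rightarrow> 'a"
    and r :: real
  assumes "\<And>j. 1 \<le> d j"
    and "orthonormal_basis (basis_index d) (\<lambda>(j, k). e j k)"
    and "0 < r"
    and "bounded_clinear T"
    and "invariant_op (block d e) T"
  shows "(T \<in> schatten_class r \<longleftrightarrow>
            summable (\<lambda>l. schatten_norm_mat r (symbol d e T l) powr r)) \<and>
         (T \<in> schatten_class r \<longrightarrow>
            schatten_norm r T = (\<Sum>l. schatten_norm_mat r (symbol d e T l) powr r) powr (1 / r)) \<and>
         (T \<in> schatten_class 1 \<longrightarrow>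
            (\<lambda>l. trace_mat (symbol d e T l)) sums trace_op T)"
proof -
  interpret invariant_operator d e T by unfold_locales fact+
  obtain f s where
    *: "singular_basis (SIGMA l:UNIV. {..<d l}) (\<lambda>(l, k). f l k) T (\<lambda>(l, k). s l k)" and
    mat: "\<And>l. singular_mat (d l) (symbol d e T l)
       (Matrix.mat (d l) (d l) (\<lambda>(a, k). cinner (f l k) (e l (Suc a)))) (s l)"
    using singular_bases_exist by blast
  interpret singular_basis "SIGMA l:UNIV. {..<d l}" "\<lambda>(l, k). f l k" T "\<lambda>(l, k). s l k" by fact
  have powr_case: "(\<lambda>p. (case p of (l, k) \<Rightarrow> s l k) powr r) = (\<lambda>(l, k). s l k powr r)" for r
    by (simp add: case_prod_unfold)
  have blocks: "schatten_norm_mat r (symbol d e T l) powr r = (\<Sum>k<d l. s l k powr r)" for l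
    using singular_mat.schatten_norm_mat_powr[OF mat \<open>0 < r\<close>] .
  have class_iff: "T \<in> schatten_class r \<longleftrightarrow>
      (\<lambda>(l, k). s l k powr r) summable_on (SIGMA l:UNIV. {..<d l})" if "0 < r" for r
    using schatten_class_iff[OF that] by (simp only: powr_case)
  have 1: "T \<in> schatten_class r \<longleftrightarrow> summable (\<lambda>l. schatten_norm_mat r (symbol d e T l) powr r)"
    by (simp add: blocks class_iff \<open>0 < r\<close> summable_on_Sigma_lessThan_iff)
  have 2: "schatten_norm r T = (\<Sum>l. schatten_norm_mat r (symbol d e T l) powr r) powr (1 / r)"
    if T: "T \<in> schatten_class r"
  proof -
    have "(\<lambda>(l, k). s l k powr r) summable_on (SIGMA l:UNIV. {..<d l})"
      using T class_iff[OF \<open>0 < r\<close>] by simp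
    from infsum_Sigma_lessThan[OF this] schatten_norm_eq[OF T \<open>0 < r\<close>] show ?thesis
      by (simp only: blocks powr_case)
  qed
  have 3: "(\<lambda>l. trace_mat (symbol d e T l)) sums trace_op T" if T: "T \<in> schatten_class 1"
  proof -
    have "(\<lambda>(l, k). s l k powr 1) summable_on (SIGMA l:UNIV. {..<d l})"
      using T class_iff[of 1] by simp
    also have "?this \<longleftrightarrow> (\<lambda>(l, k). s l k) summable_on (SIGMA l:UNIV. {..<d l})"
      by (rule summable_on_cong) (use singular_mat.s_nonneg[OF mat] in auto)
    finally have "((\<lambda>p. cinner (T ((\<lambda>(j, k). e j k) p)) ((\<lambda>(j, k). e j k) p)) has_sum trace_op T) (basis_index d)"
      by (rule trace_op_has_sum) fact
    then have "((\<lambda>l. trace_mat (symbol d e T l)) has_sum trace_op T) UNIV"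
      unfolding basis_index_def
    proof (rule has_sum_SigmaD)
      fix l
      show "((\<lambda>k. cinner (T (case (l, k) of (j, k) \<Rightarrow> e j k)) (case (l, k) of (j, k) \<Rightarrow> e j k)) has_sum
          trace_mat (symbol d e T l)) {1..d l}"
        by (rule has_sum_finiteI) (simp_all add: trace_mat_def symbol_def sum.atLeast1_atMost_eq)
    qed
    then show ?thesis by (rule has_sum_imp_sums)
  qed
  from 1 2 3 show ?thesis by blast
qed


end
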